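(* Let $L$ be a positive definite even lattice of rank one, i.e. $L=\mathbb{Z}\alpha$ with $\langle\alpha,\alpha\rangle=2k$ for some positive integer $k$. Then the $\mathbb{Z}_2$-orbifold model $V_L^+$ of the lattice vertex operator algebra $V_L$ is $C_2$-cofinite.
   Context: $V_L$ is the lattice vertex operator algebra (over $\mathbb{C}$) associated with $L$, $\theta$ is the involution of $V_L$ lifted from the $-1$-isometry of $L$, and $V_L^+=(V_L)^{\langle\theta\rangle}$ is the vertex operator subalgebra of $\theta$-fixed vectors. For a vertex operator algebra $V$ with $n$-th products $a_{(n)}b$, $C_2(V)$ is the linear span of all $a_{(-2)}b$ with $a,b\in V$, and $V$ is $C_2$-cofinite if $V/C_2(V)$ is finite dimensional. *)

theory Defs
  imports Complex_Main "HOL-Library.Multiset" "HOL-Library.Poly_Mapping"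
begin

section \<open>The \<open>C\<^sub>2\<close> condition\<close>

text \<open>
  A vertex operator algebra enters here through its scalar multiplication \<open>scale\<close>, its underlying
  subspace \<open>V\<close> and its products: \<open>nprod a n b\<close> is the product \<open>a\<^sub>(\<^sub>n\<^sub>) b\<close>.
\<close>

definition C2 ::
    "('a::field \<Rightarrow> 'b::ab_group_add \<Rightarrow> 'b) \<Rightarrow> ('b \<Rightarrow> int \<Rightarrow> 'b \<Rightarrow> 'b) \<Rightarrow> 'b set \<Rightarrow> 'b set" where
  "C2 scale nprod V = module.span scale {nprod a (-2) b | a b. a \<in> V \<and> b \<in> V}"

definition coset :: "'b::ab_group_add set \<Rightarrow> 'b \<Rightarrow> 'b set" where
  "coset W v = {v + w | w. w \<in> W}"

text \<open>The quotient \<open>V / W\<close> is spanned by the cosets of finitely many vectors.\<close>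

definition finite_dim_quotient ::
    "('a::field \<Rightarrow> 'b::ab_group_add \<Rightarrow> 'b) \<Rightarrow> 'b set \<Rightarrow> 'b set \<Rightarrow> bool" where
  "finite_dim_quotient scale V W \<longleftrightarrow>
     (\<exists>B. finite B \<and> B \<subseteq> V \<and>
        (\<forall>v\<in>V. \<exists>c. coset W v = coset W (\<Sum>b\<in>B. scale (c b) b)))"

definition C2_cofinite ::
    "('a::field \<Rightarrow> 'b::ab_group_add \<Rightarrow> 'b) \<Rightarrow> ('b \<Rightarrow> int \<Rightarrow> 'b \<Rightarrow> 'b) \<Rightarrow> 'b set \<Rightarrow> bool" where
  "C2_cofinite scale nprod V \<longleftrightarrow> finite_dim_quotient scale V (C2 scale nprod V)"

section \<open>The space \<open>V\<^sub>L\<close> for \<open>L = \<int>\<alpha>\<close>\<close>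

text \<open>
  As a vector space \<open>V\<^sub>L\<close> is the tensor product of the Fock space
  \<open>M(1) = \<complex>[\<alpha>(-1), \<alpha>(-2), \<dots>]\<close> and the group algebra \<open>\<complex>[L]\<close>. The pair
  \<open>({#p\<^sub>1, \<dots>, p\<^sub>r#}, m)\<close> indexes the basis vector
  \<open>\<alpha>(-p\<^sub>1-1) \<dots> \<alpha>(-p\<^sub>r-1) \<otimes> e\<^sup>m\<^sup>\<alpha>\<close>; note the shift by one, so that \<open>p\<close> is also the order of the
  derivative of \<open>\<alpha>(z)\<close> attached to \<open>\<alpha>(-p-1)\<close>.

  Since \<open>\<langle>m\<alpha>, n\<alpha>\<rangle> = 2kmn\<close> is always even, the commutator map \<open>(-1)\<^bsup>\<langle>m\<alpha>, n\<alpha>\<rangle>\<^esup>\<close> of the central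
  extension of \<open>L\<close> used to build \<open>V\<^sub>L\<close> is trivial and the 2-cocycle is taken to be 1, so no
  signs occur in \<open>\<complex>[L]\<close>.
\<close>

type_synonym basis_VL = "nat multiset \<times> int"
type_synonym VL = "basis_VL \<Rightarrow>\<^sub>0 complex"

definition smult_VL :: "complex \<Rightarrow> VL \<Rightarrow> VL" where
  "smult_VL c v = Poly_Mapping.map ((*) c) v"

lemma lookup_smult_VL [simp]:
  "Poly_Mapping.lookup (smult_VL c v) b = c * Poly_Mapping.lookup v b"
  by (simp add: smult_VL_def Poly_Mapping.map.rep_eq when_def)

lemma vector_space_smult_VL: "vector_space smult_VL"
  by standard (rule poly_mapping_eqI, simp add: lookup_add algebra_simps)+

definition basis_vec :: "nat multiset \<Rightarrow> int \<Rightarrow> VL" where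
  "basis_vec M m = Poly_Mapping.single (M, m) 1"

definition lin_ext :: "(nat multiset \<Rightarrow> int \<Rightarrow> VL) \<Rightarrow> VL \<Rightarrow> VL" where
  "lin_ext f v = (\<Sum>(M, m)\<in>Poly_Mapping.keys v. smult_VL (Poly_Mapping.lookup v (M, m)) (f M m))"

section \<open>Vertex operators\<close>

text \<open>
  The parameter \<open>k\<close> is such that \<open>\<langle>\<alpha>, \<alpha>\<rangle> = 2k\<close>.
\<close>

definition form_L :: "nat \<Rightarrow> int \<Rightarrow> int \<Rightarrow> int" where
  "form_L k m n = 2 * int k * m * n"

text \<open>
  The Heisenberg operators \<open>\<alpha>(n)\<close>: they satisfy
  \<open>[\<alpha>(m), \<alpha>(n)] = m \<langle>\<alpha>, \<alpha>\<rangle> \<delta>\<^bsub>m+n,0\<^esub>\<close>, the operator \<open>\<alpha>(0)\<close> acts on \<open>e\<^sup>m\<^sup>\<alpha>\<close> as \<open>\<langle>\<alpha>, m\<alpha>\<rangle>\<close>, and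
  \<open>\<alpha>(n)\<close> kills \<open>e\<^sup>m\<^sup>\<alpha>\<close> for \<open>n > 0\<close>.
\<close>

definition heis :: "nat \<Rightarrow> int \<Rightarrow> VL \<Rightarrow> VL" where
  "heis k n = lin_ext (\<lambda>M m.
     if n < 0 then basis_vec (add_mset (nat (- n - 1)) M) m
     else if n = 0 then smult_VL (of_int (form_L k 1 m)) (basis_vec M m)
     else smult_VL (of_int (n * form_L k 1 1) * of_nat (count M (nat (n - 1))))
            (basis_vec (M - {#nat (n - 1)#}) m))"

text \<open>
  A field \<open>A(z) = \<Sum>\<^sub>n A\<^sub>(\<^sub>n\<^sub>) z\<^bsup>-n-1\<^esup>\<close> is given by its modes \<open>A n\<close>. For fixed \<open>v\<close>
  one has \<open>A n v = 0\<close> for all large \<open>n\<close>, so only finitely many terms in \<open>normal_order\<close>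
  are nonzero (\<open>Sum_any\<close> would return 0 otherwise).
\<close>

type_synonym field_VL = "int \<Rightarrow> VL \<Rightarrow> VL"

definition normal_order :: "field_VL \<Rightarrow> field_VL \<Rightarrow> field_VL" where
  "normal_order A B n v =
     Sum_any (\<lambda>j. if j < 0 then A j (B (n - 1 - j) v) else B (n - 1 - j) (A j v))"

text \<open>The divided derivative \<open>(1/p!) (d/dz)\<^sup>p \<alpha>(z)\<close>, where \<open>\<alpha>(z) = \<Sum>\<^sub>n \<alpha>(n) z\<^bsup>-n-1\<^esup>\<close>.\<close>

definition deriv_heis_field :: "nat \<Rightarrow> nat \<Rightarrow> field_VL" where
  "deriv_heis_field k p n v =
     smult_VL ((-1) ^ p * (of_int n gchoose p)) (heis k (n - int p) v)"

text \<open>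
  Coefficient of \<open>x\<^sup>s\<close> in \<open>exp (\<Sum>\<^bsub>n\<ge>1\<^esub> X\<^sub>n x\<^sup>n)\<close> for linear operators \<open>X\<^sub>n\<close>: the power
  \<open>(\<Sum>\<^bsub>n\<ge>1\<^esub> X\<^sub>n x\<^sup>n)\<^sup>r\<close> contributes the products \<open>X\<^bsub>n\<^sub>1\<^esub> \<dots> X\<^bsub>n\<^sub>r\<^esub>\<close> with
  \<open>n\<^sub>1 + \<dots> + n\<^sub>r = s\<close>.
\<close>

definition exp_coeff :: "(nat \<Rightarrow> VL \<Rightarrow> VL) \<Rightarrow> nat \<Rightarrow> VL \<Rightarrow> VL" where
  "exp_coeff X s v =
     (\<Sum>ns\<in>{ns. 0 \<notin> set ns \<and> sum_list ns = s}. smult_VL (1 / fact (length ns)) (foldr X ns v))"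

text \<open>
  For \<open>\<beta> = m\<alpha>\<close>: the coefficient of \<open>z\<^sup>s\<close> in \<open>exp (\<Sum>\<^bsub>n\<ge>1\<^esub> \<beta>(-n)/n z\<^sup>n)\<close>, the coefficient of
  \<open>z\<^bsup>-s\<^esup>\<close> in \<open>exp (- \<Sum>\<^bsub>n\<ge>1\<^esub> \<beta>(n)/n z\<^bsup>-n\<^esup>)\<close>, multiplication by \<open>e\<^sup>\<beta>\<close>, and the coefficient of
  \<open>z\<^sup>s\<close> in \<open>z\<^bsup>\<beta>(0)\<^esup>\<close> (a projection, as \<open>z\<^bsup>\<beta>(0)\<^esup>\<close> acts on \<open>M(1) \<otimes> e\<^sup>l\<^sup>\<alpha>\<close> as
  \<open>z\<^bsup>\<langle>\<beta>, l\<alpha>\<rangle>\<^esup>\<close>).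
\<close>

definition exp_creation :: "nat \<Rightarrow> int \<Rightarrow> nat \<Rightarrow> VL \<Rightarrow> VL" where
  "exp_creation k m = exp_coeff (\<lambda>n v. smult_VL (of_int m / of_nat n) (heis k (- int n) v))"

definition exp_annihilation :: "nat \<Rightarrow> int \<Rightarrow> nat \<Rightarrow> VL \<Rightarrow> VL" where
  "exp_annihilation k m = exp_coeff (\<lambda>n v. smult_VL (- (of_int m / of_nat n)) (heis k (int n) v))"

definition shift_charge :: "int \<Rightarrow> VL \<Rightarrow> VL" where
  "shift_charge m = lin_ext (\<lambda>M l. basis_vec M (l + m))"

definition z_power_coeff :: "nat \<Rightarrow> int \<Rightarrow> int \<Rightarrow> VL \<Rightarrow> VL" where
  "z_power_coeff k m s = lin_ext (\<lambda>M l. if form_L k m l = s then basis_vec M l else 0)"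

text \<open>
  The field \<open>Y(e\<^sup>\<beta>, z) = exp (\<Sum>\<^bsub>n\<ge>1\<^esub> \<beta>(-n)/n z\<^sup>n) exp (- \<Sum>\<^bsub>n\<ge>1\<^esub> \<beta>(n)/n z\<^bsup>-n\<^esup>) e\<^sup>\<beta> z\<^bsup>\<beta>(0)\<^esup>\<close>,
  \<open>\<beta> = m\<alpha>\<close>. Its \<open>n\<close>-th mode is the coefficient of \<open>z\<^bsup>-n-1\<^esup>\<close>; again only finitely many
  terms are nonzero on a given \<open>v\<close>.
\<close>

definition exp_field :: "nat \<Rightarrow> int \<Rightarrow> field_VL" where
  "exp_field k m n v =
     Sum_any (\<lambda>(i, j). exp_creation k m i (exp_annihilation k m j
       (shift_charge m (z_power_coeff k m (- n - 1 - int i + int j) v))))"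

text \<open>
  \<open>Y(\<alpha>(-p\<^sub>1-1) \<dots> \<alpha>(-p\<^sub>r-1) \<otimes> e\<^sup>\<beta>, z)\<close> is the normally ordered product of the divided derivatives
  of \<open>\<alpha>(z)\<close> of orders \<open>p\<^sub>1, \<dots>, p\<^sub>r\<close> and of \<open>Y(e\<^sup>\<beta>, z)\<close>. It does not depend on the order of the
  \<open>p\<^sub>i\<close>; sorting them merely fixes a choice.
\<close>

definition basis_field :: "nat \<Rightarrow> nat multiset \<Rightarrow> int \<Rightarrow> field_VL" where
  "basis_field k M m =
     foldr (\<lambda>p. normal_order (deriv_heis_field k p)) (sorted_list_of_multiset M) (exp_field k m)"

definition nprod_VL :: "nat \<Rightarrow> VL \<Rightarrow> int \<Rightarrow> VL \<Rightarrow> VL" where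
  "nprod_VL k a n b = lin_ext (\<lambda>M m. basis_field k M m n b) a"

section \<open>The orbifold \<open>V\<^sub>L\<^sup>+\<close>\<close>

text \<open>
  The lift of the \<open>-1\<close>-isometry sends \<open>\<alpha>(-n)\<close> to \<open>-\<alpha>(-n)\<close> and \<open>e\<^sup>m\<^sup>\<alpha>\<close> to \<open>e\<^bsup>-m\<alpha>\<^esup>\<close>. Neither the
  underlying space of \<open>V\<^sub>L\<close> nor \<open>\<theta>\<close> depends on \<open>k\<close>; only the products do.
\<close>

definition theta :: "VL \<Rightarrow> VL" where
  "theta = lin_ext (\<lambda>M m. smult_VL ((-1) ^ size M) (basis_vec M (- m)))"

definition VL_plus :: "VL set" where
  "VL_plus = {v. theta v = v}"

end

(*
  Let Uhat be the space of all v in V_L with v + theta v in C_2(V_L^+); it suffices that V_L / Uhat is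
  finite dimensional. Write d_p = p! alpha(-p-1), let e^m be the vacuum of charge m, and grade V_L by
  charge, weight and length (the number of factors alpha(-p-1)).

  The (-2)-modes of alpha(-p-1)alpha(-q-1) give d_p d_{q+1} v + d_{p+1} d_q v = (shorter terms) modulo
  Uhat, and v_(-2) 1 is the translate of v, whose leading term is m d_0 v in charge m. For m > 0 these
  reduce every vector of charge m to length at most one, and the lower order terms of a relation
  between cubic monomials kill d_n e^m for n large. In charge 0 they leave the powers of alpha(-1) and the
  quadratic monomials: large quadratic monomials are killed by comparing two quartic relations, and
  large powers of alpha(-1) occur as leading terms of (alpha(-p-1) e^alpha)_(-2) e^(-alpha) (made
  theta-invariant), whose charge 2 part is already known to vanish. Finally, for m >= 21 the modes of
  alpha(-p-1) e^(10 alpha) express all vectors of charge m through vectors of smaller charge. What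
  remains are the vectors of charge and weight below fixed bounds.
*)

theory Submission
  imports Defs
begin

text \<open>Uhat allows relations to be derived for single monomials: the quadratic states are
  theta-fixed and their modes commute with theta, and v - theta v always lies in Uhat, which
  identifies charge m with -m and kills odd lengths in charge 0. The obstacle is that leading terms
  alone never give finiteness. By them d_p d_q is congruent to (-1)^p d_0 d_(p+q), so derivatives
  only move between factors; the translate removes a factor d_0, but with the coefficient m, so it
  says nothing in charge 0 and does not reach d_n e^m. The missing relations come from contractions:
  combinations of relations with the same leading terms are subtracted, and a multiple of a single
  shorter monomial remains. Most of the calculation serves to show that this scalar is nonzero. In
  charge m this works for n >= 10km+5, a bound that grows with m. Bounding the charge therefore
  needs the pairing of 10 alpha with (m-10) alpha, 20km - 200k, which exceeds 10km + 8 as soon as m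
  >= 21; the theta-partner of such a mode has charge m - 20, smaller than m in absolute
  value.\<close>

section \<open>Linear maps on V_L and their values on basis vectors\<close>

interpretation VL: vector_space smult_VL
  by (rule vector_space_smult_VL)

interpretation VL_pair: vector_space_pair smult_VL smult_VL
  by unfold_locales

abbreviation lin :: "(VL \<Rightarrow> VL) \<Rightarrow> bool" where
  "lin \<equiv> Vector_Spaces.linear smult_VL smult_VL"

lemma linI:
  assumes "\<And>v w. f (v + w) = f v + f w" "\<And>c v. f (smult_VL c v) = smult_VL c (f v)"
  shows "lin f"
  using assms by (unfold_locales) auto

lemmas lin_add = VL_pair.linear_add
  and lin_scale = VL_pair.linear_scale
  and lin_zero = VL_pair.linear_0
  and lin_diff = VL_pair.linear_diff
  and lin_sum = VL_pair.linear_sum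
  and lin_uminus = VL_pair.linear_neg

lemma lin_comp: "lin f \<Longrightarrow> lin g \<Longrightarrow> lin (\<lambda>v. f (g v))"
  by (rule linI) (simp_all add: lin_add lin_scale)

lemma lin_smult: "lin f \<Longrightarrow> lin (\<lambda>v. smult_VL c (f v))"
  by (rule VL_pair.linear_compose_scale_right)

lemma lin_plus: "lin f \<Longrightarrow> lin g \<Longrightarrow> lin (\<lambda>v. f v + g v)"
  by (rule VL_pair.linear_compose_add)

lemma lin_setsum: "(\<And>i. i \<in> S \<Longrightarrow> lin (f i)) \<Longrightarrow> lin (\<lambda>v. \<Sum>i\<in>S. f i v)"
  by (simp add: VL_pair.linear_compose_sum)

lemma lin_neg: "lin f \<Longrightarrow> lin (\<lambda>v. - f v)"
  using lin_smult[of f "-1"] by simp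

lemma lin_id: "lin (\<lambda>v. v)"
  by (rule linI) simp_all

lemma lin_const_zero: "lin (\<lambda>v. 0)"
  by (rule linI) simp_all

lemma lin_ext_superset:
  assumes "finite S" "Poly_Mapping.keys v \<subseteq> S"
  shows "lin_ext f v = (\<Sum>(M, m)\<in>S. smult_VL (Poly_Mapping.lookup v (M, m)) (f M m))"
  unfolding lin_ext_def using assms
  by (intro sum.mono_neutral_left) (auto simp: in_keys_iff)

lemma lin_lin_ext: "lin (lin_ext f)"
proof (rule linI)
  fix v w :: VL
  let ?S = "Poly_Mapping.keys v \<union> Poly_Mapping.keys w"
  have "Poly_Mapping.keys (v + w) \<subseteq> ?S"
    by (rule keys_add)
  then show "lin_ext f (v + w) = lin_ext f v + lin_ext f w"
    by (simp add: lin_ext_superset[of ?S] lookup_add VL.scale_left_distrib sum.distrib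
        split_beta)
next
  fix c and v :: VL
  have "Poly_Mapping.keys (smult_VL c v) \<subseteq> Poly_Mapping.keys v"
    by (auto simp: in_keys_iff)
  then show "lin_ext f (smult_VL c v) = smult_VL c (lin_ext f v)"
    by (simp add: lin_ext_superset[of "Poly_Mapping.keys v"] VL.scale_sum_right split_beta)
qed

lemma lin_ext_basis [simp]: "lin_ext f (basis_vec M m) = f M m"
  by (simp add: lin_ext_def basis_vec_def)

lemma span_basis: "VL.span (range (\<lambda>(M, m). basis_vec M m)) = UNIV"
proof -
  have "v \<in> VL.span (range (\<lambda>(M, m). basis_vec M m))" for v
  proof -
    have "v = (\<Sum>b\<in>Poly_Mapping.keys v. smult_VL (Poly_Mapping.lookup v b) (basis_vec (fst b) (snd b)))"
      by (rule poly_mapping_eqI)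
        (auto simp: basis_vec_def lookup_sum lookup_single when_def in_keys_iff
          if_distrib[of "(*) _"] cong: if_cong)
    also have "\<dots> \<in> VL.span (range (\<lambda>(M, m). basis_vec M m))"
      by (intro VL.span_sum VL.span_scale VL.span_base) (auto simp: image_iff)
    finally show ?thesis .
  qed
  then show ?thesis by auto
qed

lemma span_into:
  assumes "v \<in> VL.span S" "lin f" "VL.subspace T" "\<And>x. x \<in> S \<Longrightarrow> f x \<in> T"
  shows "f v \<in> T"
  using assms(1)
proof (induction rule: VL.span_induct_alt)
  case base
  then show ?case
    using assms(2,3) by (simp add: lin_zero VL.subspace_0)
next
  case (step c x y)
  then show ?case
    using assms by (simp add: lin_add lin_scale VL.subspace_add VL.subspace_scale)
qed

lemma basis_induct [case_names basis add scale]: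
  assumes "\<And>M m. P (basis_vec M m)" "\<And>v w. P v \<Longrightarrow> P w \<Longrightarrow> P (v + w)"
    "\<And>c v. P v \<Longrightarrow> P (smult_VL c v)"
  shows "P v"
proof -
  have "v \<in> VL.span (range (\<lambda>(M, m). basis_vec M m))"
    by (simp add: span_basis)
  then show ?thesis
  proof (induction rule: VL.span_induct_alt)
    case base
    show ?case using assms(3)[OF assms(1), of 0] by simp
  qed (auto intro: assms)
qed

lemma lin_eqI:
  assumes "lin f" "lin g" "\<And>M m. f (basis_vec M m) = g (basis_vec M m)"
  shows "f v = g v"
  by (induction v rule: basis_induct) (simp_all add: assms lin_add lin_scale)

section \<open>Heisenberg operators\<close>

text \<open>\<open>p! \<alpha>(-p-1)\<close>, i.e. creation by the \<open>p\<close>-th ordinary (not divided) derivative of \<open>\<alpha>(z)\<close>.\<close>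

definition cre :: "nat \<Rightarrow> VL \<Rightarrow> VL" where
  "cre p = lin_ext (\<lambda>M m. smult_VL (fact p) (basis_vec (add_mset p M) m))"

lemma lin_cre: "lin (cre p)"
  unfolding cre_def by (rule lin_lin_ext)

lemmas cre_linear [simp] =
  lin_add[OF lin_cre] lin_scale[OF lin_cre] lin_zero[OF lin_cre] lin_diff[OF lin_cre]
  lin_uminus[OF lin_cre]

lemma cre_basis: "cre p (basis_vec M m) = smult_VL (fact p) (basis_vec (add_mset p M) m)"
  by (simp add: cre_def)

lemma cre_commute: "cre p (cre q v) = cre q (cre p v)"
  by (rule lin_eqI[of "\<lambda>v. cre p (cre q v)" "\<lambda>v. cre q (cre p v)"])
    (simp_all add: lin_comp lin_cre cre_basis add_mset_commute mult.commute)

lemma lin_heis: "lin (heis k n)"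
  unfolding heis_def by (rule lin_lin_ext)

lemmas heis_linear [simp] =
  lin_add[OF lin_heis] lin_scale[OF lin_heis] lin_zero[OF lin_heis] lin_diff[OF lin_heis]
  lin_uminus[OF lin_heis]

lemma lin_theta: "lin theta"
  unfolding theta_def by (rule lin_lin_ext)

lemmas theta_linear [simp] =
  lin_add[OF lin_theta] lin_scale[OF lin_theta] lin_zero[OF lin_theta] lin_diff[OF lin_theta]
  lin_uminus[OF lin_theta]

lemma theta_basis: "theta (basis_vec M m) = smult_VL ((-1) ^ size M) (basis_vec M (- m))"
  by (simp add: theta_def)

lemma theta_theta [simp]: "theta (theta v) = v"
  by (rule lin_eqI[of "\<lambda>v. theta (theta v)" "\<lambda>v. v"])
    (simp_all add: lin_comp lin_theta lin_id theta_basis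
      flip: power_mult_distrib)

lemma heis_basis:
  "heis k n (basis_vec M m) =
    (if n < 0 then basis_vec (add_mset (nat (- n - 1)) M) m
     else if n = 0 then smult_VL (of_int (form_L k 1 m)) (basis_vec M m)
     else smult_VL (of_int (n * form_L k 1 1) * of_nat (count M (nat (n - 1))))
            (basis_vec (M - {#nat (n - 1)#}) m))"
  by (simp add: heis_def)

lemma heis_creation: "heis k (- int p - 1) v = smult_VL (1 / fact p) (cre p v)"
  by (rule lin_eqI[of "heis k (- int p - 1)" "\<lambda>v. smult_VL (1 / fact p) (cre p v)"])
    (simp_all add: lin_heis lin_smult lin_cre cre_basis heis_basis)

lemma theta_heis: "theta (heis k n v) = - heis k n (theta v)"
proof (rule lin_eqI[of "\<lambda>v. theta (heis k n v)" "\<lambda>v. - heis k n (theta v)"])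
  show "lin (\<lambda>v. - heis k n (theta v))"
    by (rule lin_neg, rule lin_comp[OF lin_heis lin_theta])
  show "lin (\<lambda>v. theta (heis k n v))"
    by (rule lin_comp[OF lin_theta lin_heis])
  fix M :: "nat multiset" and m
  consider "n < 0" | "n = 0" | "n > 0" "nat (n - 1) \<in># M" | "n > 0" "nat (n - 1) \<notin># M"
    by linarith
  then show "theta (heis k n (basis_vec M m)) = - heis k n (theta (basis_vec M m))"
  proof cases
    case 1 then show ?thesis
 by (simp add: theta_basis heis_basis)
next
    case 2 then show ?thesis
 by (simp add: theta_basis heis_basis form_L_def)
next
    case 3
    then obtain N where "M = add_mset (nat (n - 1)) N"
      by (metis multi_member_split)
    with 3 show ?thesis
      by (simp add: theta_basis heis_basis form_L_def)
  next
    case 4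
    then show ?thesis
      by (simp add: theta_basis heis_basis not_in_iff)
  qed
qed

lemma theta_cre: "theta (cre p v) = - cre p (theta v)"
  by (rule lin_eqI[of "\<lambda>v. theta (cre p v)" "\<lambda>v. - cre p (theta v)"])
    (simp_all add: lin_comp lin_neg lin_theta lin_cre theta_basis cre_basis  mult.commute)

text \<open>The Heisenberg commutator: n * 2k * r! with n = r + 1 is 2k (r+1)!.\<close>

lemma heis_cre:
  assumes "n \<ge> 0"
  shows "heis k n (cre r v) =
    cre r (heis k n v) + (if n = int r + 1 then smult_VL (2 * of_nat k * fact (r + 1)) v else 0)"
    (is "_ = _ + ?c v")
proof (rule lin_eqI[of "\<lambda>v. heis k n (cre r v)" "\<lambda>v. cre r (heis k n v) + ?c v"])
  show "lin (\<lambda>v. cre r (heis k n v) + ?c v)"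
    by (rule linI) (simp_all add: VL.scale_right_distrib mult.commute)
  show "lin (\<lambda>v. heis k n (cre r v))"
    by (rule lin_comp[OF lin_heis lin_cre])
  fix M :: "nat multiset" and m
  have "n = 0 \<or> n > 0 \<and> n \<noteq> int r + 1 \<or> n = int r + 1"
    using assms by auto
  then consider "n = 0" | "n > 0" "n \<noteq> int r + 1" "nat (n - 1) \<in># M"
    | "n > 0" "n \<noteq> int r + 1" "nat (n - 1) \<notin># M" | "n = int r + 1" "r \<in># M"
    | "n = int r + 1" "r \<notin># M"
    by metis
  then show "heis k n (cre r (basis_vec M m)) = cre r (heis k n (basis_vec M m)) + ?c (basis_vec M m)"
  proof cases
    case 1 then show ?thesis by (simp add: cre_basis heis_basis)
  next
    case 2
    then have r: "nat (n - 1) \<noteq> r" by auto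
    then have "add_mset r M - {#nat (n - 1)#} = add_mset r (M - {#nat (n - 1)#})"
      by (rule diff_union_swap[symmetric])
    with 2 r show ?thesis
      by (simp add: cre_basis heis_basis mult.commute)
  next
    case 3
    then have r: "nat (n - 1) \<noteq> r" by auto
    with 3 show ?thesis
      by (simp add: cre_basis heis_basis not_in_iff)
  next
    case 4
    then obtain N where "M = add_mset r N"
      by (metis multi_member_split)
    with 4 show ?thesis
      by (simp add: cre_basis heis_basis form_L_def distrib_left distrib_right mult_ac
          flip: VL.scale_left_distrib)
  next
    case 5
    then show ?thesis
      by (simp add: cre_basis heis_basis form_L_def not_in_iff mult_ac)
  qed
qed

section \<open>Grading by charge, weight and length\<close>

text \<open>Only the weight of the Fock space factor: the contribution k m^2 of e^m is left out,
  which is why \<open>form_L\<close> enters the weights of \<open>exp_field\<close> below.\<close>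

definition wt :: "nat multiset \<Rightarrow> nat" where
  "wt M = (\<Sum>p\<in>#M. Suc p)"

lemma wt_simps [simp]: "wt {#} = 0" "wt (add_mset p M) = Suc (p + wt M)"
  by (simp_all add: wt_def)

lemma size_le_wt: "size M \<le> wt M"
  by (induction M) auto

text \<open>Exact in the weight but a filtration in the length, since relations hold modulo shorter
  terms. With integer indices a negative weight or length gives the zero space, which replaces many
  vanishing conditions.\<close>

definition graded :: "int \<Rightarrow> int \<Rightarrow> int \<Rightarrow> VL set" where
  "graded m W r = VL.span {basis_vec M m | M. int (wt M) = W \<and> int (size M) \<le> r}"

lemma subspace_graded: "VL.subspace (graded m W r)"
  by (simp add: graded_def)

lemma basis_in_graded: "int (wt M) = W \<Longrightarrow> int (size M) \<le> r \<Longrightarrow> basis_vec M m \<in> graded m W r"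
  unfolding graded_def by (intro VL.span_base) auto

lemma graded_mono: "r \<le> r' \<Longrightarrow> graded m W r \<subseteq> graded m W r'"
  unfolding graded_def by (intro VL.span_mono) auto

lemma graded_into:
  assumes "v \<in> graded m W r" "lin f" "VL.subspace T"
    "\<And>M. int (wt M) = W \<Longrightarrow> int (size M) \<le> r \<Longrightarrow> f (basis_vec M m) \<in> T"
  shows "f v \<in> T"
  using assms(1,2,3) unfolding graded_def by (rule span_into) (auto intro: assms(4))

lemma graded_subset:
  assumes "VL.subspace T"
    "\<And>M. int (wt M) = W \<Longrightarrow> int (size M) \<le> r \<Longrightarrow> basis_vec M m \<in> T"
  shows "graded m W r \<subseteq> T"
  using graded_into[OF _ lin_id assms] by blast

lemma graded_neg_zero:
  assumes "v \<in> graded m W r" "W < 0 \<or> r < 0"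
  shows "v = 0"
proof -
  have "{basis_vec M m | M. int (wt M) = W \<and> int (size M) \<le> r} = {}"
    using assms(2) by auto
  with assms(1) show ?thesis by (simp add: graded_def)
qed

lemma cre_graded: "v \<in> graded m W r \<Longrightarrow> cre p v \<in> graded m (W + int p + 1) (r + 1)"
  by (erule graded_into[OF _ lin_cre subspace_graded])
    (auto simp: cre_basis intro!: VL.subspace_scale subspace_graded basis_in_graded)

lemma heis_graded:
  assumes "v \<in> graded m W r" "n \<ge> 0"
  shows "heis k n v \<in> graded m (W - n) (if n = 0 then r else r - 1)"
  using assms(1) lin_heis subspace_graded
proof (rule graded_into)
  fix M assume M: "int (wt M) = W" "int (size M) \<le> r"
  consider "n = 0" | "n > 0" "nat (n - 1) \<in># M" | "n > 0" "nat (n - 1) \<notin># M"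
    using assms by linarith
  then show "heis k n (basis_vec M m) \<in> graded m (W - n) (if n = 0 then r else r - 1)"
  proof cases
    case 2
    then obtain N where "M = add_mset (nat (n - 1)) N"
      by (metis multi_member_split)
    with 2 M show ?thesis
      by (auto simp: heis_basis intro!: VL.subspace_scale subspace_graded basis_in_graded)
  qed (use M in \<open>auto simp: heis_basis not_in_iff VL.subspace_0[OF subspace_graded]
        intro!: VL.subspace_scale subspace_graded basis_in_graded\<close>)
qed

lemma heis_graded_le:
  assumes "v \<in> graded m W r" "n \<ge> 0"
  shows "heis k n v \<in> graded m (W - n) r"
  using heis_graded[OF assms, of k] graded_mono[of "r - 1" r m "W - n"] by (cases "n = 0") auto

section \<open>Quadratic fields\<close>

definition ann :: "nat \<Rightarrow> nat \<Rightarrow> nat \<Rightarrow> VL \<Rightarrow> VL" where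
  "ann k q j v = smult_VL (fact q) (deriv_heis_field k q (int j) v)"

lemma lin_deriv_heis_field: "lin (deriv_heis_field k p n)"
  unfolding deriv_heis_field_def by (rule lin_smult[OF lin_heis])

lemma lin_ann: "lin (ann k q j)"
  unfolding ann_def by (rule lin_smult[OF lin_deriv_heis_field])

lemmas ann_linear [simp] =
  lin_add[OF lin_ann] lin_scale[OF lin_ann] lin_zero[OF lin_ann] lin_diff[OF lin_ann]
  lin_uminus[OF lin_ann]

lemmas deriv_heis_field_linear [simp] =
  lin_add[OF lin_deriv_heis_field] lin_scale[OF lin_deriv_heis_field]
  lin_zero[OF lin_deriv_heis_field]

lemma deriv_heis_field_nonneg: "deriv_heis_field k q (int j) v = smult_VL (1 / fact q) (ann k q j v)"
  by (simp add: ann_def)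

text \<open>The binomial coefficient (n+p choose p) times 1/(p+n)! collapses to 1/(p! n!). The
  normalisation of \<open>cre\<close> is chosen for this: it makes the leading coefficients in
  \<open>quad\<close> equal to 1.\<close>

lemma deriv_heis_field_neg:
  "deriv_heis_field k p (- int n - 1) v = smult_VL (1 / (fact p * fact n)) (cre (p + n) v)"
proof -
  have "(of_int (- int n - 1) gchoose p) = (- 1) ^ p * ((of_nat n + 1 + of_nat p - 1) gchoose p :: complex)"
    using gbinomial_minus[of "of_nat n + 1 :: complex" p] by simp
  also have "of_nat n + 1 + of_nat p - 1 = (of_nat (n + p) :: complex)"
    by simp
  also have "(of_nat (n + p) gchoose p) = (fact (n + p) / (fact p * fact n) :: complex)"
    unfolding binomial_gbinomial[symmetric] by (subst binomial_fact) auto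
  finally have "(- 1) ^ p * (of_int (- int n - 1) gchoose p) = (fact (n + p) / (fact p * fact n) :: complex)"
    by (metis left_minus_one_mult_self)
  moreover have "- int n - 1 - int p = - int (p + n) - 1"
    by simp
  ultimately have "deriv_heis_field k p (- int n - 1) v =
      smult_VL (fact (n + p) / (fact p * fact n) * (1 / fact (p + n))) (cre (p + n) v)"
    unfolding deriv_heis_field_def by (simp only: heis_creation VL.scale_scale)
  moreover have "fact (n + p) / (fact p * fact n) * (1 / fact (p + n)) = (1 / (fact p * fact n) :: complex)"
    by (simp add: add.commute[of n p])
  ultimately show ?thesis
    by (simp only:)
qed

lemma theta_ann: "theta (ann k q j v) = - ann k q j (theta v)"
  by (simp add: ann_def deriv_heis_field_def theta_heis)

text \<open>The binomial coefficient vanishes for j < q, so only alpha(n) with n >= 0 occurs and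
  neither weight nor length can grow.\<close>

lemma ann_heis:
  "ann k q j v = smult_VL ((- 1) ^ q * fact q * of_nat (j choose q)) (heis k (int j - int q) v)"
  by (simp add: ann_def deriv_heis_field_def binomial_gbinomial mult_ac)

text \<open>At j = q+r+1 the product q! (r+1)! (j choose q) is j!, so the commutator is (-1)^q 2k
  j!.\<close>

lemma ann_cre:
  "ann k q j (cre r v) = cre r (ann k q j v) +
     (if j = q + r + 1 then smult_VL ((- 1) ^ q * 2 * of_nat k * fact j) v else 0)"
proof (cases "j < q")
  case True
  then show ?thesis by (simp add: ann_heis)
next
  case False
  have "fact q * fact (r + 1) * of_nat ((q + r + 1) choose q) = (fact (q + r + 1) :: complex)"
    using binomial_fact_lemma[of q "q + r + 1"]
    by (metis (no_types, opaque_lifting) add.assoc add_diff_cancel_left' le_add1 of_nat_fact of_nat_mult)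
  with False show ?thesis
    by (auto simp: ann_heis heis_cre VL.scale_right_distrib mult_ac simp del: fact_Suc binomial_Suc_Suc)
qed

lemma ann_vac:
  "ann k q j (basis_vec {#} m) =
     (if j = q then smult_VL ((- 1) ^ q * fact q * (2 * of_nat k * of_int m)) (basis_vec {#} m) else 0)"
  by (cases j q rule: linorder_cases) (auto simp: ann_heis heis_basis form_L_def)

lemma ann_graded:
  assumes "v \<in> graded m W r"
  shows "ann k q j v \<in> graded m (W - (int j - int q)) r"
proof (cases "j < q")
  case True
  then show ?thesis by (simp add: ann_heis binomial_eq_0 VL.subspace_0[OF subspace_graded])
next
  case False
  with heis_graded_le[OF assms, of "int j - int q" k] show ?thesis
    unfolding ann_heis by (intro VL.subspace_scale subspace_graded) simp
qed

lemma ann_eq_0: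
  assumes "v \<in> graded m W r" "int j > W + int q"
  shows "ann k q j v = 0"
  using graded_neg_zero[OF ann_graded[OF assms(1), of k q j]] assms(2) by simp

text \<open>This is p! q! times the (-2)-mode of alpha(-p-1) alpha(-q-1), sorted into its two purely
  creating terms and the terms with one annihilation operator. The bound \<open>J\<close> truncates
  a sum that is finite on each vector.\<close>

definition quad :: "nat \<Rightarrow> nat \<Rightarrow> nat \<Rightarrow> nat \<Rightarrow> VL \<Rightarrow> VL" where
  "quad k J p q v = cre p (cre (Suc q) v) + cre (Suc p) (cre q v) +
     (\<Sum>j<J. smult_VL (1 / fact (j + 2)) (cre (p + j + 2) (ann k q j v) + cre (q + j + 2) (ann k p j v)))"

lemma quad_commute: "quad k J p q v = quad k J q p v"
  by (simp add: quad_def cre_commute add.commute)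

lemma quad_theta: "quad k J p q (theta v) = theta (quad k J p q v)"
  by (simp add: quad_def theta_cre theta_ann lin_sum[OF lin_theta])

lemma quad_add: "quad k J p q (v + w) = quad k J p q v + quad k J p q w"
  by (simp add: quad_def sum.distrib VL.scale_right_distrib)

section \<open>The (-2)-modes of the states alpha(-p-1) alpha(-q-1)\<close>

lemma Sum_any_superset:
  assumes "finite S" "\<And>x. x \<notin> S \<Longrightarrow> f x = 0"
  shows "Sum_any f = sum f S"
  using assms by (intro Sum_any.expand_superset) auto

lemma exp_coeff_indices_0: "{ns. 0 \<notin> set ns \<and> sum_list ns = (0::nat)} = {[]}"
proof -
  have "ns = []" if "0 \<notin> set ns" "sum_list ns = (0::nat)" for ns
    using that by (cases ns) auto
  then show ?thesis by auto
qed

lemma exp_coeff_0: "exp_coeff X 0 v = v"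
  unfolding exp_coeff_def exp_coeff_indices_0 by simp

lemma exp_coeff_trivial:
  assumes "\<And>n v. X n v = 0"
  shows "exp_coeff X s v = (if s = 0 then v else 0)"
proof (cases "s = 0")
  case False
  have "foldr X ns v = 0" if "sum_list ns = s" for ns
    using that False by (cases ns) (auto simp: assms)
  then have "exp_coeff X s v = 0"
    unfolding exp_coeff_def by (intro sum.neutral) simp
  with False show ?thesis by simp
qed (simp add: exp_coeff_0)

lemma exp_field_0: "exp_field k 0 n v = (if n = - 1 then v else 0)"
proof -
  have sh: "shift_charge 0 w = w" for w
    unfolding shift_charge_def by (rule lin_eqI[OF lin_lin_ext lin_id]) simp
  have z: "z_power_coeff k 0 s v = (if s = 0 then v else 0)" for s
    unfolding z_power_coeff_def
    by (rule lin_eqI[OF lin_lin_ext, of "\<lambda>v. if s = 0 then v else 0"])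
      (cases "s = 0"; simp add: lin_id lin_const_zero form_L_def)+
  show ?thesis
    unfolding exp_field_def exp_creation_def exp_annihilation_def
    by (subst Sum_any_superset[of "{(0, 0)}"]) (auto simp: exp_coeff_trivial sh z split: if_splits)
qed

lemma normal_order_exp_field_0:
  "normal_order (deriv_heis_field k q) (exp_field k 0) n v = deriv_heis_field k q n v"
  unfolding normal_order_def by (subst Sum_any_superset[of "{n}"]) (auto simp: exp_field_0)

lemma normal_order_deriv_heis_fields:
  assumes "\<And>j. j \<ge> J \<Longrightarrow> ann k p j v = 0" "\<And>j. j \<ge> J \<Longrightarrow> ann k q j v = 0"
  shows "normal_order (deriv_heis_field k p) (deriv_heis_field k q) (- 2) v =
    smult_VL (1 / (fact p * fact q)) (quad k J p q v)"
proof -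
  let ?d = "deriv_heis_field k"
  let ?f = "\<lambda>j. if j < 0 then ?d p j (?d q (- 2 - 1 - j) v) else ?d q (- 2 - 1 - j) (?d p j v)"
  have large: "?d r j v = 0" if "j \<ge> int J" "r = p \<or> r = q" for r j
    using deriv_heis_field_nonneg[of k r "nat j" v] assms(1)[of "nat j"] assms(2)[of "nat j"] that
    by auto
  have "normal_order (?d p) (?d q) (- 2) v = sum ?f {- int J - 2..<int J}"
    unfolding normal_order_def
    by (rule Sum_any_superset) (auto simp: large)
  \<comment> \<open>Index -n-1 of the first field leaves mode n-2 for the second. For n = 0, 1 both
    create, which gives the leading terms; annihilation starts at n = 2, hence the range up to
    \<open>J + 2\<close>.\<close>
  also have "{- int J - 2..<int J} = (\<lambda>n. - int n - 1) ` {..<J + 2} \<union> int ` {..<J}"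
  proof -
    have "x \<in> (\<lambda>n. - int n - 1) ` {..<J + 2}" if "- int J - 2 \<le> x" "x < 0" for x
      using that by (intro image_eqI[of _ _ "nat (- x - 1)"]) auto
    moreover have "x \<in> int ` {..<J}" if "x < int J" "x \<ge> 0" for x
      using that by (intro image_eqI[of _ _ "nat x"]) auto
    ultimately have "{- int J - 2..<int J} \<subseteq> (\<lambda>n. - int n - 1) ` {..<J + 2} \<union> int ` {..<J}"
      by (meson UnI1 UnI2 atLeastLessThan_iff not_le subsetI)
    then show ?thesis by (intro equalityI) auto
  qed
  also have "sum ?f \<dots> = sum ?f ((\<lambda>n. - int n - 1) ` {..<J + 2}) + sum ?f (int ` {..<J})"
    by (rule sum.union_disjoint) auto
  also have "sum ?f ((\<lambda>n. - int n - 1) ` {..<J + 2}) = (\<Sum>n<J + 2. ?d p (- int n - 1) (?d q (int n - 2) v))"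
    by (subst sum.reindex) (auto simp: inj_on_def algebra_simps)
  also have "\<dots> = ?d p (- int 0 - 1) (?d q (- int 1 - 1) v) + ?d p (- int 1 - 1) (?d q (- int 0 - 1) v)
      + (\<Sum>n<J. ?d p (- int (n + 2) - 1) (?d q (int n) v))"
    by (simp add: sum.lessThan_Suc_shift del: sum.lessThan_Suc)
  also have "sum ?f (int ` {..<J}) = (\<Sum>n<J. ?d q (- int (n + 2) - 1) (?d p (int n) v))"
    by (subst sum.reindex) (auto simp: inj_on_def intro!: sum.cong arg_cong2[of _ _ _ _ "?d q"])
  finally have "normal_order (?d p) (?d q) (- 2) v =
      ?d p (- int 0 - 1) (?d q (- int 1 - 1) v) + ?d p (- int 1 - 1) (?d q (- int 0 - 1) v)
      + (\<Sum>n<J. ?d p (- int (n + 2) - 1) (?d q (int n) v))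
      + (\<Sum>n<J. ?d q (- int (n + 2) - 1) (?d p (int n) v))" .
  moreover have "?d r (- int (n + 2) - 1) (?d s (int n) v) =
      smult_VL (1 / (fact r * fact s)) (smult_VL (1 / fact (n + 2)) (cre (r + n + 2) (ann k s n v)))"
    for r s n
    unfolding deriv_heis_field_neg deriv_heis_field_nonneg cre_linear VL.scale_scale
    by (simp only: add.assoc) (simp only: times_divide_times_eq mult_ac mult_1)
  moreover have "?d p (- int 0 - 1) (?d q (- int 1 - 1) v) =
      smult_VL (1 / (fact p * fact q)) (cre p (cre (Suc q) v))"
    unfolding deriv_heis_field_neg by simp
  moreover have "?d p (- int 1 - 1) (?d q (- int 0 - 1) v) =
      smult_VL (1 / (fact p * fact q)) (cre (Suc p) (cre q v))"
    unfolding deriv_heis_field_neg by simp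
  ultimately show ?thesis
    by (simp only: quad_def VL.scale_right_distrib VL.scale_sum_right sum.distrib add.assoc
        mult.commute[of "fact q"])
qed

lemma nprod_basis: "nprod_VL k (basis_vec M m) n v = basis_field k M m n v"
  by (simp add: nprod_VL_def)

lemma nprod_add: "nprod_VL k (a + b) n v = nprod_VL k a n v + nprod_VL k b n v"
  unfolding nprod_VL_def by (rule lin_add[OF lin_lin_ext])

lemma nprod_scale: "nprod_VL k (smult_VL c a) n v = smult_VL c (nprod_VL k a n v)"
  unfolding nprod_VL_def by (rule lin_scale[OF lin_lin_ext])

text \<open>Sorting in \<open>basis_field\<close> may put p and q in either order; the symmetry of
  \<open>quad\<close> makes the two cases agree.\<close>

lemma nprod_quadratic:
  assumes "\<And>j. j \<ge> J \<Longrightarrow> ann k p j v = 0" "\<And>j. j \<ge> J \<Longrightarrow> ann k q j v = 0"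
  shows "nprod_VL k (basis_vec {#p, q#} 0) (- 2) v = smult_VL (1 / (fact p * fact q)) (quad k J p q v)"
proof -
  have "normal_order (deriv_heis_field k q) (exp_field k 0) = deriv_heis_field k q" for q
    by (rule ext)+ (rule normal_order_exp_field_0)
  then show ?thesis
    using normal_order_deriv_heis_fields[of J k p v q] normal_order_deriv_heis_fields[of J k q v p] assms
    by (simp add: nprod_basis basis_field_def quad_commute[of k J q p] mult.commute)
qed

section \<open>The preimage of \<open>C\<^sub>2\<close> under symmetrisation\<close>

definition Uhat :: "nat \<Rightarrow> VL set" where
  "Uhat k = {v. v + theta v \<in> C2 smult_VL (nprod_VL k) VL_plus}"

lemma subspace_C2: "VL.subspace (C2 smult_VL (nprod_VL k) VL_plus)"
  unfolding C2_def by (rule VL.subspace_span)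

lemma nprod_in_C2:
  "a \<in> VL_plus \<Longrightarrow> b \<in> VL_plus \<Longrightarrow> nprod_VL k a (- 2) b \<in> C2 smult_VL (nprod_VL k) VL_plus"
  unfolding C2_def by (intro VL.span_base) auto

lemma subspace_Uhat: "VL.subspace (Uhat k)"
proof (rule VL.subspaceI)
  show "0 \<in> Uhat k"
    by (simp add: Uhat_def VL.subspace_0[OF subspace_C2])
next
  fix v w assume "v \<in> Uhat k" "w \<in> Uhat k"
  then show "v + w \<in> Uhat k"
    using VL.subspace_add[OF subspace_C2, of "v + theta v" k "w + theta w"]
    by (simp add: Uhat_def add.assoc add.left_commute)
next
  fix c v assume "v \<in> Uhat k"
  then show "smult_VL c v \<in> Uhat k"
    using VL.subspace_scale[OF subspace_C2, of "v + theta v" k c]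
    by (simp add: Uhat_def VL.scale_right_distrib)
qed

lemma sym_in_VL_plus: "v + theta v \<in> VL_plus"
  by (simp add: VL_plus_def add.commute)

lemma Uhat_minus_theta: "v - theta v \<in> Uhat k"
  by (simp add: Uhat_def VL.subspace_0[OF subspace_C2])

text \<open>The quadratic state is theta-fixed and \<open>quad\<close> commutes with
  \<open>theta\<close>, so its product with v + theta v is the symmetrisation of \<open>quad\<close>
  applied to v.\<close>

lemma quad_in_Uhat:
  assumes "\<And>j. j \<ge> J \<Longrightarrow> ann k p j v = 0" "\<And>j. j \<ge> J \<Longrightarrow> ann k q j v = 0"
  shows "quad k J p q v \<in> Uhat k"
proof -
  have "ann k r j (v + theta v) = 0" if "ann k r j v = 0" for r j
    using that theta_ann[of k r j v] by simp
  with assms have "nprod_VL k (basis_vec {#p, q#} 0) (- 2) (v + theta v) =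
      smult_VL (1 / (fact p * fact q)) (quad k J p q (v + theta v))"
    by (intro nprod_quadratic) auto
  moreover have "basis_vec {#p, q#} 0 \<in> VL_plus"
    by (simp add: VL_plus_def theta_basis)
  ultimately have "smult_VL (1 / (fact p * fact q)) (quad k J p q (v + theta v))
      \<in> C2 smult_VL (nprod_VL k) VL_plus"
    using nprod_in_C2[OF _ sym_in_VL_plus] by metis
  from VL.subspace_scale[OF subspace_C2 this, of "fact p * fact q"] show ?thesis
    by (simp add: Uhat_def quad_add quad_theta)
qed

section \<open>Relations from quadratic fields\<close>

text \<open>The contribution of \<open>\<alpha>(0)\<close> to a quadratic mode on \<open>e\<^sup>m\<^sup>\<alpha>\<close>, up to the factor \<open>2km\<close>.\<close>

definition zero_mode_coeff :: "nat \<Rightarrow> complex" where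
  "zero_mode_coeff q = (- 1) ^ q / (of_nat (q + 1) * of_nat (q + 2))"

abbreviation evec :: "int \<Rightarrow> VL" where
  "evec m \<equiv> basis_vec {#} m"

lemma quad_vac:
  assumes "p < J" "q < J"
  shows "quad k J p q (evec m) = cre p (cre (Suc q) (evec m)) + cre (Suc p) (cre q (evec m))
    + smult_VL (2 * of_nat k * of_int m * (zero_mode_coeff p + zero_mode_coeff q)) (cre (p + q + 2) (evec m))"
proof -
  have one: "(\<Sum>j<J. smult_VL (1 / fact (j + 2)) (cre (p + j + 2) (ann k q j (evec m)))) =
      smult_VL (2 * of_nat k * of_int m * zero_mode_coeff q) (cre (p + q + 2) (evec m))"
    if "q < J" for p q
  proof -
    have "(\<Sum>j<J. smult_VL (1 / fact (j + 2)) (cre (p + j + 2) (ann k q j (evec m)))) =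
      (\<Sum>j<J. if j = q then smult_VL (1 / fact (j + 2)) (cre (p + j + 2)
         (smult_VL ((- 1) ^ q * fact q * (2 * of_nat k * of_int m)) (evec m))) else 0)"
      by (intro sum.cong) (auto simp: ann_vac)
    also have "\<dots> = smult_VL (1 / fact (q + 2) * ((- 1) ^ q * fact q * (2 * of_nat k * of_int m)))
        (cre (p + q + 2) (evec m))"
      using that by (simp del: fact_Suc)
    also have "1 / fact (q + 2) * ((- 1) ^ q * fact q * (2 * of_nat k * of_int m)) =
        2 * of_nat k * of_int m * zero_mode_coeff q"
      by (simp add: zero_mode_coeff_def divide_simps)
    finally show ?thesis .
  qed
  show ?thesis
    using one[OF assms(2), of p] one[OF assms(1), of q]
    by (simp add: quad_def VL.scale_right_distrib sum.distrib VL.scale_left_distrib distrib_left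
        add.commute add.left_commute del: fact_Suc)
qed

text \<open>Moving \<open>cre r\<close> out of the mode costs one contraction in each annihilation
  sum, at j = q+r+1 and j = p+r+1; the quotient j!/(j+2)! produces the denominators.\<close>

lemma quad_cre:
  assumes "p + r + 1 < J" "q + r + 1 < J"
  shows "quad k J p q (cre r v) = cre r (quad k J p q v)
    + smult_VL (2 * of_nat k * ((- 1) ^ q / (of_nat (q + r + 2) * of_nat (q + r + 3))
        + (- 1) ^ p / (of_nat (p + r + 2) * of_nat (p + r + 3)))) (cre (p + q + r + 3) v)"
proof -
  let ?C = "\<lambda>q. (- 1) ^ q / (of_nat (q + r + 2) * of_nat (q + r + 3)) :: complex"
  have one: "(\<Sum>j<J. smult_VL (1 / fact (j + 2)) (cre (p + j + 2) (ann k q j (cre r v)))) =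
      cre r (\<Sum>j<J. smult_VL (1 / fact (j + 2)) (cre (p + j + 2) (ann k q j v))) +
      smult_VL (2 * of_nat k * ?C q) (cre (p + q + r + 3) v)"
    if "q + r + 1 < J" for p q
  proof -
    have "(\<Sum>j<J. smult_VL (1 / fact (j + 2)) (cre (p + j + 2) (ann k q j (cre r v)))) =
      (\<Sum>j<J. cre r (smult_VL (1 / fact (j + 2)) (cre (p + j + 2) (ann k q j v))) +
       (if j = q + r + 1 then smult_VL (1 / fact (j + 2)) (cre (p + j + 2)
         (smult_VL ((- 1) ^ q * 2 * of_nat k * fact j) v)) else 0))"
      by (intro sum.cong) (auto simp: ann_cre VL.scale_right_distrib cre_commute[of _ r] simp del: fact_Suc)
    also have "\<dots> = cre r (\<Sum>j<J. smult_VL (1 / fact (j + 2)) (cre (p + j + 2) (ann k q j v))) +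
        smult_VL (1 / fact (q + r + 1 + 2) * ((- 1) ^ q * 2 * of_nat k * fact (q + r + 1)))
        (cre (p + (q + r + 1) + 2) v)"
      using that by (simp add: sum.distrib lin_sum[OF lin_cre] del: fact_Suc)
    also have "1 / fact (q + r + 1 + 2) * ((- 1) ^ q * 2 * of_nat k * fact (q + r + 1)) =
        2 * of_nat k * ?C q"
    proof -
      have "fact (q + r + 1 + 2) = (of_nat (q + r + 3) * of_nat (q + r + 2) * fact (q + r + 1) :: complex)"
        by (simp add: numeral_eq_Suc algebra_simps)
      moreover have "fact (q + r + 1) \<noteq> (0::complex)"
        by (rule fact_nonzero)
      ultimately show ?thesis
        by (simp only: ) (simp add: field_simps del: fact_Suc of_nat_add of_nat_Suc)
    qed
    also have "p + (q + r + 1) + 2 = p + q + r + 3"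
      by simp
    finally show ?thesis .
  qed
  have "q + p + r + 3 = p + q + r + 3" by simp
  then show ?thesis
    using one[OF assms(2), of p] one[OF assms(1), of q]
    by (simp add: quad_def VL.scale_right_distrib sum.distrib VL.scale_left_distrib distrib_left
        cre_commute[of _ r] add.commute add.left_commute del: fact_Suc of_nat_add of_nat_Suc)
qed

lemma ann_vac_0: "q < j \<Longrightarrow> ann k q j (evec m) = 0"
  by (simp add: ann_vac)

lemma ann_cre_0: "ann k q j v = 0 \<Longrightarrow> q + r + 1 < j \<Longrightarrow> ann k q j (cre r v) = 0"
  by (simp add: ann_cre)

text \<open>The value of \<open>quad\<close> on e^m. The last term comes from alpha(0) and
  disappears in charge 0.\<close>

definition rel0 :: "nat \<Rightarrow> int \<Rightarrow> nat \<Rightarrow> nat \<Rightarrow> VL" where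
  "rel0 k m p q = cre p (cre (Suc q) (evec m)) + cre (Suc p) (cre q (evec m))
    + smult_VL (2 * of_nat k * of_int m * (zero_mode_coeff p + zero_mode_coeff q)) (cre (p + q + 2) (evec m))"

text \<open>The contribution of contracting one factor of a quadratic mode with \<open>r! \<alpha>(-r-1)\<close>.\<close>

definition contr :: "nat \<Rightarrow> nat \<Rightarrow> nat \<Rightarrow> nat \<Rightarrow> complex" where
  "contr k p q r = 2 * of_nat k * ((- 1) ^ q / (of_nat (q + r + 2) * of_nat (q + r + 3))
        + (- 1) ^ p / (of_nat (p + r + 2) * of_nat (p + r + 3)))"

lemma rel0_in_Uhat: "rel0 k m p q \<in> Uhat k"
proof -
  let ?J = "p + q + 1"
  have "quad k ?J p q (evec m) \<in> Uhat k"
    by (rule quad_in_Uhat) (auto intro: ann_vac_0)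
  then show ?thesis
    by (simp add: quad_vac rel0_def)
qed

lemma rel1_in_Uhat:
  "cre r (rel0 k m p q) + smult_VL (contr k p q r) (cre (p + q + r + 3) (evec m)) \<in> Uhat k"
proof -
  let ?J = "p + q + r + 2"
  have "quad k ?J p q (cre r (evec m)) \<in> Uhat k"
    by (rule quad_in_Uhat) (auto intro!: ann_cre_0 ann_vac_0)
  then show ?thesis
    by (simp add: quad_vac quad_cre rel0_def contr_def del: of_nat_add of_nat_Suc)
qed

lemma rel2_in_Uhat:
  "cre r (cre s (rel0 k m p q)) + smult_VL (contr k p q s) (cre r (cre (p + q + s + 3) (evec m)))
   + smult_VL (contr k p q r) (cre (p + q + r + 3) (cre s (evec m))) \<in> Uhat k"
proof -
  let ?J = "p + q + r + s + 2"
  have "quad k ?J p q (cre r (cre s (evec m))) \<in> Uhat k"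
    by (rule quad_in_Uhat) (auto intro!: ann_cre_0 ann_vac_0)
  then show ?thesis
    by (simp add: quad_vac quad_cre rel0_def contr_def del: of_nat_add of_nat_Suc)
qed

text \<open>Each correction term is one annihilation, which does not raise the length, followed by
  one creation: length at most r + 1, against r + 2 for the leading terms.\<close>

lemma quad_leading:
  assumes "v \<in> graded m W r"
  shows "\<exists>w \<in> graded m (W + int (p + q) + 3) (r + 1).
    cre p (cre (Suc q) v) + cre (Suc p) (cre q v) + w \<in> Uhat k"
proof -
  let ?J = "nat W + p + q + 1"
  have cre_ann: "cre (p + j + 2) (ann k q j v) \<in> graded m (W + int (p + q) + 3) (r + 1)" for p q j
    using cre_graded[OF ann_graded[OF assms, of k q j], of "p + j + 2"] by (simp add: algebra_simps)
  have "quad k ?J p q v \<in> Uhat k"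
    by (rule quad_in_Uhat) (auto intro!: ann_eq_0[OF assms])
  moreover have "(\<Sum>j<?J. smult_VL (1 / fact (j + 2)) (cre (p + j + 2) (ann k q j v)
      + cre (q + j + 2) (ann k p j v))) \<in> graded m (W + int (p + q) + 3) (r + 1)"
    using cre_ann[of p _ q] cre_ann[of q _ p]
    by (intro VL.subspace_sum VL.subspace_scale VL.subspace_add subspace_graded)
      (simp_all add: add.commute)
  ultimately show ?thesis
    unfolding quad_def by blast
qed

section \<open>Fields of charged vectors\<close>

lemma lin_Sum_any:
  assumes "lin f" "finite {x. g x \<noteq> 0}"
  shows "f (Sum_any g) = Sum_any (\<lambda>x. f (g x))"
proof -
  have "Sum_any (\<lambda>x. f (g x)) = (\<Sum>x\<in>{x. g x \<noteq> 0}. f (g x))"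
    by (rule Sum_any_superset[OF assms(2)]) (auto simp: lin_zero[OF assms(1)])
  then show ?thesis
    by (simp add: Sum_any.expand_set lin_sum[OF assms(1)])
qed

lemma lin_Sum_any_family:
  assumes "\<And>x. lin (f x)" "\<And>v. finite {x. f x v \<noteq> 0}"
  shows "lin (\<lambda>v. Sum_any (\<lambda>x. f x v))"
proof (rule linI)
  fix v w
  show "Sum_any (\<lambda>x. f x (v + w)) = Sum_any (\<lambda>x. f x v) + Sum_any (\<lambda>x. f x w)"
    using Sum_any.distrib[OF assms(2)[of v] assms(2)[of w]] by (simp add: lin_add[OF assms(1)])
next
  fix c v
  have "lin (\<lambda>v. smult_VL c v)"
    by (rule lin_smult[OF lin_id])
  from lin_Sum_any[OF this assms(2)[of v]]
  show "Sum_any (\<lambda>x. f x (smult_VL c v)) = smult_VL c (Sum_any (\<lambda>x. f x v))"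
    by (simp add: lin_scale[OF assms(1)])
qed

text \<open>Truncation makes the sums in \<open>normal_order\<close> finite, so that
  \<open>Sum_any\<close> never falls back on its default value 0 and is linear.\<close>

definition is_field :: "field_VL \<Rightarrow> bool" where
  "is_field A \<longleftrightarrow> (\<forall>n. lin (A n)) \<and> (\<forall>v. \<exists>N. \<forall>n\<ge>N. A n v = 0)"

lemma is_fieldI:
  assumes "\<And>n. lin (A n)" "\<And>M m. \<exists>N. \<forall>n\<ge>N. A n (basis_vec M m) = 0"
  shows "is_field A"
proof -
  have "\<exists>N. \<forall>n\<ge>N. A n v = 0" for v
  proof (induction v rule: basis_induct)
    case (add v w)
    then obtain N1 N2 where "\<forall>n\<ge>N1. A n v = 0" "\<forall>n\<ge>N2. A n w = 0"
      by blast
    then show ?case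
      by (intro exI[of _ "max N1 N2"]) (simp add: lin_add[OF assms(1)])
  next
    case (scale c v)
    then show ?case
      by (metis VL.scale_zero_right lin_scale[OF assms(1)])
  qed (rule assms(2))
  then show ?thesis
    using assms(1) by (simp add: is_field_def)
qed

lemma is_field_deriv_heis_field: "is_field (deriv_heis_field k p)"
proof (rule is_fieldI[OF lin_deriv_heis_field])
  fix M m
  have "deriv_heis_field k p n (basis_vec M m) = 0" if "n \<ge> int (wt M) + int p + 1" for n
  proof -
    have "ann k p (nat n) (basis_vec M m) = 0"
      using that by (intro ann_eq_0[OF basis_in_graded[OF refl order_refl]]) auto
    then show ?thesis
      using deriv_heis_field_nonneg[of k p "nat n" "basis_vec M m"] that by simp
  qed
  then show "\<exists>N. \<forall>n\<ge>N. deriv_heis_field k p n (basis_vec M m) = 0"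
    by blast
qed

lemma normal_order_finite:
  assumes "is_field A" "is_field B"
  shows "finite {j. (if j < 0 then A j (B (n - 1 - j) v) else B (n - 1 - j) (A j v)) \<noteq> 0}"
proof -
  have lin: "lin (A j)" "lin (B j)" for j
    using assms by (auto simp: is_field_def)
  obtain N1 N2 where N: "\<forall>n\<ge>N1. A n v = 0" "\<forall>n\<ge>N2. B n v = 0"
    using assms unfolding is_field_def by metis
  have "j \<in> {min 0 (n - 1 - N2)..max 0 N1}"
    if "(if j < 0 then A j (B (n - 1 - j) v) else B (n - 1 - j) (A j v)) \<noteq> 0" for j
  proof -
    have "j < N1 \<or> j < 0"
    proof (rule ccontr)
      assume "\<not> (j < N1 \<or> j < 0)"
      with that N(1) show False by (auto simp: lin_zero[OF lin(2)])
    qed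
    moreover have "n - 1 - j < N2 \<or> j \<ge> 0"
    proof (rule ccontr)
      assume "\<not> (n - 1 - j < N2 \<or> j \<ge> 0)"
      with that N(2) show False by (auto simp: lin_zero[OF lin(1)])
    qed
    ultimately show ?thesis
      by auto
  qed
  then have "{j. (if j < 0 then A j (B (n - 1 - j) v) else B (n - 1 - j) (A j v)) \<noteq> 0}
      \<subseteq> {min 0 (n - 1 - N2)..max 0 N1}"
    by blast
  then show ?thesis
    by (rule finite_subset) simp
qed

lemma lin_normal_order:
  assumes "is_field A" "is_field B"
  shows "lin (normal_order A B n)"
proof -
  have lin: "lin (A j)" "lin (B j)" for j
    using assms by (auto simp: is_field_def)
  have "lin (\<lambda>v. if j < 0 then A j (B (n - 1 - j) v) else B (n - 1 - j) (A j v))" for j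
    by (rule linI) (simp_all add: lin_add[OF lin(1)] lin_add[OF lin(2)] lin_scale[OF lin(1)]
        lin_scale[OF lin(2)])
  from lin_Sum_any_family[OF this normal_order_finite[OF assms]] show ?thesis
    by (simp add: normal_order_def[abs_def])
qed

text \<open>The second field may change under conjugation because \<open>theta\<close> turns Y(e^s,
  z) into Y(e^(-s), z); the sign belongs to the one factor alpha(z).\<close>

lemma theta_normal_order:
  assumes "is_field A" "is_field B"
    and A: "\<And>n v. theta (A n v) = - A n (theta v)" and B: "\<And>n v. theta (B n v) = B' n (theta v)"
  shows "theta (normal_order A B n v) = - normal_order A B' n (theta v)"
proof -
  have fin: "finite {j. (if j < 0 then A j (B (n - 1 - j) v) else B (n - 1 - j) (A j v)) \<noteq> 0}"
    by (rule normal_order_finite[OF assms(1,2)])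
  have lin: "lin (A j)" "lin (B j)" for j
    using assms by (auto simp: is_field_def)
  have B': "B' j (- w) = - B' j w" for j w
    using B[of j "theta w"] B[of j "- theta w"] by (simp add: lin_uminus[OF lin(2)])
  have "theta (normal_order A B n v) =
      Sum_any (\<lambda>j. - (if j < 0 then A j (B' (n - 1 - j) (theta v)) else B' (n - 1 - j) (A j (theta v))))"
    unfolding normal_order_def
    by (subst lin_Sum_any[OF lin_theta fin]) (auto simp: A B B' intro!: Sum_any.cong)
  also have "\<dots> = - normal_order A B' n (theta v)"
    unfolding normal_order_def by (simp add: Sum_any.expand_set sum_negf)
  finally show ?thesis .
qed

section \<open>The field of e^s: linearity, \<open>theta\<close> and grading\<close>

lemma lin_foldr: "(\<And>n. lin (X n)) \<Longrightarrow> lin (\<lambda>v. foldr X ns v)"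
proof (induction ns)
  case Nil
  then show ?case using lin_id by simp
next
  case (Cons n ns)
  from lin_comp[OF Cons(2) Cons(1)[OF Cons(2)], of n] show ?case by simp
qed

lemma lin_exp_coeff:
  assumes "\<And>n. lin (X n)"
  shows "lin (exp_coeff X s)"
  unfolding exp_coeff_def[abs_def] by (intro lin_setsum lin_smult lin_foldr assms)

lemma lin_exp_creation: "lin (exp_creation k s t)"
  unfolding exp_creation_def by (rule lin_exp_coeff) (rule lin_smult[OF lin_heis])

lemma lin_exp_annihilation: "lin (exp_annihilation k s t)"
  unfolding exp_annihilation_def by (rule lin_exp_coeff) (rule lin_smult[OF lin_heis])

lemmas exp_creation_linear [simp] =
  lin_add[OF lin_exp_creation] lin_scale[OF lin_exp_creation] lin_zero[OF lin_exp_creation]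

lemmas exp_annihilation_linear [simp] =
  lin_add[OF lin_exp_annihilation] lin_scale[OF lin_exp_annihilation]
  lin_zero[OF lin_exp_annihilation]

lemma theta_exp_coeff:
  assumes "\<And>n v. theta (X n v) = Y n (theta v)"
  shows "theta (exp_coeff X s v) = exp_coeff Y s (theta v)"
proof -
  have "theta (foldr X ns v) = foldr Y ns (theta v)" for ns
    by (induction ns) (simp_all add: assms)
  then show ?thesis
    by (simp add: exp_coeff_def lin_sum[OF lin_theta])
qed

lemma theta_exp_creation: "theta (exp_creation k s t v) = exp_creation k (- s) t (theta v)"
  unfolding exp_creation_def by (rule theta_exp_coeff) (simp add: theta_heis)

lemma theta_exp_annihilation: "theta (exp_annihilation k s t v) = exp_annihilation k (- s) t (theta v)"
  unfolding exp_annihilation_def by (rule theta_exp_coeff) (simp add: theta_heis)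

lemma lin_shift_charge: "lin (shift_charge s)"
  unfolding shift_charge_def by (rule lin_lin_ext)

lemma lin_z_power_coeff: "lin (z_power_coeff k s t)"
  unfolding z_power_coeff_def by (rule lin_lin_ext)

lemmas shift_z_linear [simp] =
  lin_add[OF lin_shift_charge] lin_scale[OF lin_shift_charge] lin_zero[OF lin_shift_charge]
  lin_add[OF lin_z_power_coeff] lin_scale[OF lin_z_power_coeff] lin_zero[OF lin_z_power_coeff]

lemma shift_charge_basis [simp]: "shift_charge s (basis_vec M l) = basis_vec M (l + s)"
  by (simp add: shift_charge_def)

lemma z_power_coeff_basis:
  "z_power_coeff k s t (basis_vec M l) = (if form_L k s l = t then basis_vec M l else 0)"
  by (simp add: z_power_coeff_def)

lemma theta_shift_charge: "theta (shift_charge s v) = shift_charge (- s) (theta v)"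
  by (rule lin_eqI[of "\<lambda>v. theta (shift_charge s v)" "\<lambda>v. shift_charge (- s) (theta v)"])
    (simp_all add: lin_comp[OF lin_theta lin_shift_charge] lin_comp[OF lin_shift_charge lin_theta]
      theta_basis)

lemma theta_z_power_coeff: "theta (z_power_coeff k s t v) = z_power_coeff k (- s) t (theta v)"
  by (rule lin_eqI[of "\<lambda>v. theta (z_power_coeff k s t v)" "\<lambda>v. z_power_coeff k (- s) t (theta v)"])
    (simp_all add: lin_comp[OF lin_theta lin_z_power_coeff] lin_comp[OF lin_z_power_coeff lin_theta]
      theta_basis z_power_coeff_basis form_L_def)

lemma exp_creation_0 [simp]: "exp_creation k s 0 v = v"
  by (simp add: exp_creation_def exp_coeff_0)

lemma exp_annihilation_0 [simp]: "exp_annihilation k s 0 v = v"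
  by (simp add: exp_annihilation_def exp_coeff_0)

text \<open>The sign \<open>a\<close> covers both exponentials: 1 for creation, -1 for
  annihilation.\<close>

lemma foldr_graded:
  assumes "\<And>n W r v. n > 0 \<Longrightarrow> v \<in> graded m W r \<Longrightarrow> X n v \<in> graded m (W + a * int n) (r + a)"
    and "v \<in> graded m W r" "0 \<notin> set ns"
  shows "foldr X ns v \<in> graded m (W + a * int (sum_list ns)) (r + a * int (length ns))"
  using assms(3)
proof (induction ns)
  case (Cons n ns)
  then show ?case
    using assms(1)[of n "foldr X ns v" "W + a * int (sum_list ns)" "r + a * int (length ns)"]
    by (simp add: algebra_simps)
qed (use assms(2) in simp)

lemma length_le_sum_list: "0 \<notin> set ns \<Longrightarrow> length ns \<le> sum_list (ns :: nat list)"
  by (induction ns) auto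

lemma length_eq_sum_list:
  "0 \<notin> set ns \<Longrightarrow> length ns = sum_list (ns :: nat list) \<Longrightarrow> ns = replicate (length ns) 1"
proof (induction ns)
  case (Cons n ns)
  then have "n = 1 \<and> length ns = sum_list ns"
    using length_le_sum_list[of ns] by simp
  with Cons show ?case
    by (metis list.set_intros(2) length_Cons replicate_Suc)
qed simp

lemma heis_neg_graded:
  assumes "v \<in> graded m W r" "n > 0"
  shows "heis k (- int n) v \<in> graded m (W + int n) (r + 1)"
proof -
  have "heis k (- int n) v = smult_VL (1 / fact (n - 1)) (cre (n - 1) v)"
    using heis_creation[of k "n - 1" v] assms(2) by (simp add: of_nat_diff)
  moreover have "cre (n - 1) v \<in> graded m (W + int n) (r + 1)"
    using cre_graded[OF assms(1), of "n - 1"] assms(2) by (simp add: of_nat_diff)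
  ultimately show ?thesis
    by (simp add: VL.subspace_scale[OF subspace_graded])
qed

lemma exp_creation_graded:
  assumes "v \<in> graded m W r"
  shows "exp_creation k s t v \<in> graded m (W + int t) (r + int t)"
  unfolding exp_creation_def exp_coeff_def
proof (intro VL.subspace_sum VL.subspace_scale subspace_graded)
  let ?X = "\<lambda>n v. smult_VL (of_int s / of_nat n) (heis k (- int n) v)"
  fix ns :: "nat list" assume ns: "ns \<in> {ns. 0 \<notin> set ns \<and> sum_list ns = t}"
  have "foldr ?X ns v \<in> graded m (W + 1 * int (sum_list ns)) (r + 1 * int (length ns))"
    using ns assms by (intro foldr_graded) (auto intro!: VL.subspace_scale subspace_graded heis_neg_graded)
  with ns length_le_sum_list[of ns] graded_mono[of "r + int (length ns)" "r + int t"]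
  show "foldr ?X ns v \<in> graded m (W + int t) (r + int t)"
    by auto
qed

lemma exp_annihilation_graded:
  assumes "v \<in> graded m W r" "t > 0"
  shows "exp_annihilation k s t v \<in> graded m (W - int t) (r - 1)"
  unfolding exp_annihilation_def exp_coeff_def
proof (intro VL.subspace_sum VL.subspace_scale subspace_graded)
  let ?X = "\<lambda>n v. smult_VL (- (of_int s / of_nat n)) (heis k (int n) v)"
  fix ns :: "nat list" assume ns: "ns \<in> {ns. 0 \<notin> set ns \<and> sum_list ns = t}"
  have "heis k (int n) w \<in> graded m (W - int n) (r - 1)" if "w \<in> graded m W r" "n > 0" for n w W r
    using heis_graded[OF that(1), of "int n"] that(2) by simp
  then have "foldr ?X ns v \<in> graded m (W + (- 1) * int (sum_list ns)) (r + (- 1) * int (length ns))"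
    using ns assms
    by (intro foldr_graded) (auto intro!: VL.subspace_neg VL.subspace_scale subspace_graded)
  moreover have "int (length ns) \<ge> 1"
    using ns assms(2) by (cases ns) auto
  then have "graded m (W + (- 1) * int (sum_list ns)) (r + (- 1) * int (length ns)) \<subseteq> graded m (W - int t) (r - 1)"
    using ns graded_mono[of "r - int (length ns)" "r - 1" m "W - int t"] by (cases "ns = []") simp_all
  ultimately show "foldr ?X ns v \<in> graded m (W - int t) (r - 1)"
    by blast
qed

lemma exp_annihilation_eq_0:
  assumes "v \<in> graded m W r" "int t > W"
  shows "exp_annihilation k s t v = 0"
proof (cases "t = 0")
  case True
  with assms graded_neg_zero[OF assms(1)] show ?thesis by simp
next
  case False
  then show ?thesis
    using graded_neg_zero[OF exp_annihilation_graded[OF assms(1), of t k s]] assms(2) by simp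
qed

lemma foldr_creation_replicate:
  "foldr (\<lambda>n v. smult_VL (of_int s / of_nat n) (heis k (- int n) v)) (replicate t 1) (basis_vec {#} m) =
    smult_VL (of_int s ^ t) (basis_vec (replicate_mset t 0) m)"
  by (induction t) (simp_all add: heis_basis mult.commute)

text \<open>Only the list \<open>[1, \<dots>, 1]\<close> of length \<open>t\<close> contributes a monomial of length \<open>t\<close>.\<close>

lemma exp_creation_leading:
  assumes "t > 0"
  shows "exp_creation k s t (basis_vec {#} m) -
    smult_VL (of_int s ^ t / fact t) (basis_vec (replicate_mset t 0) m) \<in> graded m (int t) (int t - 1)"
proof -
  let ?X = "\<lambda>n v. smult_VL (of_int s / of_nat n) (heis k (- int n) v)"
  let ?I = "{ns. 0 \<notin> set ns \<and> sum_list ns = t}"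
  let ?f = "\<lambda>ns. smult_VL (1 / fact (length ns)) (foldr ?X ns (basis_vec {#} m))"
  have "?I \<subseteq> {ns. set ns \<subseteq> {..t} \<and> length ns \<le> t}"
    using length_le_sum_list member_le_sum_list by fastforce
  then have fin: "finite ?I"
    by (rule finite_subset) (simp add: finite_lists_length_le)
  have mem: "replicate t 1 \<in> ?I"
    using assms by (simp add: sum_list_replicate)
  have "exp_creation k s t (basis_vec {#} m) = ?f (replicate t 1) + sum ?f (?I - {replicate t 1})"
    unfolding exp_creation_def exp_coeff_def by (rule sum.remove[OF fin mem])
  moreover have "?f (replicate t 1) = smult_VL (of_int s ^ t / fact t) (basis_vec (replicate_mset t 0) m)"
    unfolding foldr_creation_replicate by simp
  moreover have "sum ?f (?I - {replicate t 1}) \<in> graded m (int t) (int t - 1)"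
  proof (intro VL.subspace_sum VL.subspace_scale subspace_graded)
    fix ns assume ns: "ns \<in> ?I - {replicate t 1}"
    then have "length ns < t"
      using length_le_sum_list[of ns] length_eq_sum_list[of ns] by force
    moreover have "foldr ?X ns (basis_vec {#} m) \<in> graded m (0 + 1 * int (sum_list ns)) (0 + 1 * int (length ns))"
      using ns by (intro foldr_graded)
        (auto intro!: VL.subspace_scale subspace_graded heis_neg_graded basis_in_graded)
    ultimately show "foldr ?X ns (basis_vec {#} m) \<in> graded m (int t) (int t - 1)"
      using ns assms graded_mono[of "int (length ns)" "int t - 1" m "int t"] by auto
  qed
  ultimately show ?thesis
    by simp
qed

definition exp_term :: "nat \<Rightarrow> int \<Rightarrow> int \<Rightarrow> nat \<times> nat \<Rightarrow> VL \<Rightarrow> VL" where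
  "exp_term k s n x v = exp_creation k s (fst x) (exp_annihilation k s (snd x)
     (shift_charge s (z_power_coeff k s (- n - 1 - int (fst x) + int (snd x)) v)))"

lemma exp_field_eq: "exp_field k s n v = Sum_any (\<lambda>x. exp_term k s n x v)"
  by (simp add: exp_field_def exp_term_def case_prod_unfold)

lemma lin_exp_term: "lin (exp_term k s n x)"
  by (rule linI) (simp_all add: exp_term_def)

lemma theta_exp_term: "theta (exp_term k s n x v) = exp_term k (- s) n x (theta v)"
  by (simp add: exp_term_def theta_exp_creation theta_exp_annihilation theta_shift_charge
      theta_z_power_coeff)

lemma lin_eq_on_graded:
  assumes "v \<in> graded m W r" "lin f" "lin g"
    "\<And>M. int (wt M) = W \<Longrightarrow> int (size M) \<le> r \<Longrightarrow> f (basis_vec M m) = g (basis_vec M m)"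
  shows "f v = g v"
proof -
  have "f v - g v \<in> {0}"
    using assms(1)
  proof (rule graded_into[where f = "\<lambda>v. f v - g v"])
    show "lin (\<lambda>v. f v - g v)"
      using VL_pair.linear_compose_sub[OF assms(2,3)] .
  qed (simp_all add: assms(4) VL.subspace_single_0)
  then show ?thesis by simp
qed

lemma shift_charge_graded: "v \<in> graded l W r \<Longrightarrow> shift_charge s v \<in> graded (l + s) W r"
  by (erule graded_into[OF _ lin_shift_charge subspace_graded]) (simp add: basis_in_graded)

lemma z_power_coeff_graded:
  "v \<in> graded l W r \<Longrightarrow> z_power_coeff k s t v = (if form_L k s l = t then v else 0)"
  by (erule lin_eq_on_graded[OF _ lin_z_power_coeff])
    (cases "form_L k s l = t"; simp add: lin_id lin_const_zero z_power_coeff_basis)+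

lemma exp_term_graded:
  assumes "v \<in> graded l W r"
  shows "exp_term k s n (i, j) v =
    (if int i = int j - n - 1 - form_L k s l
     then exp_creation k s i (exp_annihilation k s j (shift_charge s v)) else 0)"
  by (auto simp: exp_term_def z_power_coeff_graded[OF assms])

text \<open>On a fixed charge \<open>z_power_coeff\<close> lets a single power of z through, so the
  annihilation degree j determines the creation degree; annihilation beyond the weight is 0, which
  bounds j.\<close>

lemma exp_field_graded:
  assumes "v \<in> graded l W r" "W \<le> int N"
  shows "exp_field k s n v = (\<Sum>j\<le>N. if int j - n - 1 - form_L k s l \<ge> 0
     then exp_creation k s (nat (int j - n - 1 - form_L k s l))
       (exp_annihilation k s j (shift_charge s v)) else 0)"
    and "finite {x. exp_term k s n x v \<noteq> 0}"
proof -
  let ?i = "\<lambda>j. nat (int j - n - 1 - form_L k s l)"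
  have *: "x \<in> (\<lambda>j. (?i j, j)) ` {..N}" if "exp_term k s n x v \<noteq> 0" for x
  proof -
    obtain i j where x: "x = (i, j)" by force
    from that have "int i = int j - n - 1 - form_L k s l"
      and nz: "exp_annihilation k s j (shift_charge s v) \<noteq> 0"
      unfolding x exp_term_graded[OF assms(1)] by (auto split: if_splits)
    moreover have "j \<le> N"
      using exp_annihilation_eq_0[OF shift_charge_graded[OF assms(1)], of j k s s] nz assms(2)
      by force
    ultimately show ?thesis
      unfolding x by (intro image_eqI[of _ _ j]) auto
  qed
  then have "{x. exp_term k s n x v \<noteq> 0} \<subseteq> (\<lambda>j. (?i j, j)) ` {..N}"
    by blast
  then show "finite {x. exp_term k s n x v \<noteq> 0}"
    by (rule finite_subset) simp
  have "exp_field k s n v = (\<Sum>x\<in>(\<lambda>j. (?i j, j)) ` {..N}. exp_term k s n x v)"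
    unfolding exp_field_eq by (rule Sum_any_superset) (use * in auto)
  also have "\<dots> = (\<Sum>j\<le>N. exp_term k s n (?i j, j) v)"
    by (subst sum.reindex) (auto simp: inj_on_def)
  also have "\<dots> = (\<Sum>j\<le>N. if int j - n - 1 - form_L k s l \<ge> 0
     then exp_creation k s (?i j) (exp_annihilation k s j (shift_charge s v)) else 0)"
    by (intro sum.cong) (auto simp: exp_term_graded[OF assms(1)])
  finally show "exp_field k s n v = \<dots>" .
qed

lemma exp_term_finite: "finite {x. exp_term k s n x v \<noteq> 0}"
proof (induction v rule: basis_induct)
  case (basis M m)
  show ?case
    by (rule exp_field_graded(2)[OF basis_in_graded[OF refl order_refl] order_refl])
next
  case (add v w)
  have "{x. exp_term k s n x (v + w) \<noteq> 0} \<subseteq> {x. exp_term k s n x v \<noteq> 0} \<union> {x. exp_term k s n x w \<noteq> 0}"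
    by (auto simp: lin_add[OF lin_exp_term])
  with add show ?case
    by (meson finite_UnI finite_subset)
next
  case (scale c v)
  have "{x. exp_term k s n x (smult_VL c v) \<noteq> 0} \<subseteq> {x. exp_term k s n x v \<noteq> 0}"
    by (auto simp: lin_scale[OF lin_exp_term])
  with scale show ?case
    by (meson finite_subset)
qed

lemma lin_exp_field: "lin (exp_field k s n)"
  using lin_Sum_any_family[of "\<lambda>x. exp_term k s n x", OF lin_exp_term exp_term_finite]
  by (simp add: exp_field_eq[abs_def])

lemmas exp_field_linear [simp] =
  lin_add[OF lin_exp_field] lin_scale[OF lin_exp_field] lin_zero[OF lin_exp_field]

lemma theta_exp_field: "theta (exp_field k s n v) = exp_field k (- s) n (theta v)"
  unfolding exp_field_eq by (simp add: lin_Sum_any[OF lin_theta exp_term_finite] theta_exp_term)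

lemma is_field_exp_field: "is_field (exp_field k s)"
proof (rule is_fieldI[OF lin_exp_field])
  fix M m
  have "exp_field k s n (basis_vec M m) = 0" if "n \<ge> int (wt M) - form_L k s m" for n
    using that
    by (subst exp_field_graded(1)[OF basis_in_graded[OF refl order_refl] order_refl])
      (auto intro!: sum.neutral)
  then show "\<exists>N. \<forall>n\<ge>N. exp_field k s n (basis_vec M m) = 0"
    by blast
qed

text \<open>The mode relevant for \<open>C\<^sub>2\<close> of the field attached to \<open>\<alpha>(-p-1) \<otimes> e\<^sup>s\<^sup>\<alpha>\<close>.\<close>

definition charged_mode :: "nat \<Rightarrow> nat \<Rightarrow> int \<Rightarrow> VL \<Rightarrow> VL" where
  "charged_mode k p s = normal_order (deriv_heis_field k p) (exp_field k s) (- 2)"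

lemma lin_charged_mode: "lin (charged_mode k p s)"
  unfolding charged_mode_def by (rule lin_normal_order[OF is_field_deriv_heis_field is_field_exp_field])

lemma theta_charged_mode: "theta (charged_mode k p s v) = - charged_mode k p (- s) (theta v)"
  unfolding charged_mode_def
  by (rule theta_normal_order[OF is_field_deriv_heis_field is_field_exp_field])
    (simp_all add: theta_exp_field deriv_heis_field_def theta_heis)

text \<open>With a = alpha(-p-1) e^s, the state a + theta a is a difference of states of charges s
  and -s. Its product with v + theta v has four terms, which pair up to the symmetrisation of the
  difference.\<close>

lemma charged_mode_in_Uhat: "charged_mode k p s v - charged_mode k p (- s) v \<in> Uhat k"
proof -
  let ?N = "charged_mode k p" and ?a = "basis_vec {#p#} s"
  have "nprod_VL k (basis_vec {#p#} s) (- 2) w = ?N s w" for s w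
    by (simp add: nprod_basis basis_field_def charged_mode_def)
  then have "nprod_VL k (?a + theta ?a) (- 2) (v + theta v) = ?N s (v + theta v) - ?N (- s) (v + theta v)"
    using nprod_scale[of k "- 1" "basis_vec {#p#} (- s)"] nprod_add[of k ?a "- basis_vec {#p#} (- s)"]
    by (simp add: theta_basis)
  also have "\<dots> = (?N s v - ?N (- s) v) + theta (?N s v - ?N (- s) v)"
    by (simp add: lin_add[OF lin_charged_mode] theta_charged_mode)
  finally show ?thesis
    using nprod_in_C2[OF sym_in_VL_plus[of ?a] sym_in_VL_plus[of v], of k] by (simp add: Uhat_def)
qed

lemma charged_mode_expand:
  assumes "\<And>j. j \<ge> J \<Longrightarrow> ann k p j v = 0" "\<And>i. i \<ge> J \<Longrightarrow> exp_field k s (int i - 2) v = 0"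
  shows "charged_mode k p s v =
    (\<Sum>i<J. smult_VL (1 / (fact p * fact i)) (cre (p + i) (exp_field k s (int i - 2) v))) +
    (\<Sum>j<J. smult_VL (1 / fact p) (exp_field k s (- int j - 3) (ann k p j v)))"
proof -
  let ?d = "deriv_heis_field k p" and ?e = "exp_field k s"
  let ?f = "\<lambda>j. if j < 0 then ?d j (?e (- 2 - 1 - j) v) else ?e (- 2 - 1 - j) (?d j v)"
  have 1: "?f j = 0" if "j \<ge> int J" for j
    using deriv_heis_field_nonneg[of k p "nat j" v] assms(1)[of "nat j"] that by simp
  have 2: "?f j = 0" if "j < - int J" for j
  proof -
    have "int (nat (- 1 - j)) - 2 = - 2 - 1 - j"
      using that by simp
    with assms(2)[of "nat (- 1 - j)"] that show ?thesis by simp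
  qed
  have "charged_mode k p s v = sum ?f {- int J..<int J}"
    unfolding charged_mode_def normal_order_def
    by (rule Sum_any_superset) (use 1 2 in force)+
  also have "{- int J..<int J} = (\<lambda>n. - int n - 1) ` {..<J} \<union> int ` {..<J}"
  proof -
    have "x \<in> (\<lambda>n. - int n - 1) ` {..<J}" if "- int J \<le> x" "x < 0" for x
      using that by (intro image_eqI[of _ _ "nat (- x - 1)"]) auto
    moreover have "x \<in> int ` {..<J}" if "x < int J" "x \<ge> 0" for x
      using that by (intro image_eqI[of _ _ "nat x"]) auto
    ultimately have "{- int J..<int J} \<subseteq> (\<lambda>n. - int n - 1) ` {..<J} \<union> int ` {..<J}"
      by (meson UnI1 UnI2 atLeastLessThan_iff not_le subsetI)
    then show ?thesis by (intro equalityI) auto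
  qed
  also have "sum ?f \<dots> = sum ?f ((\<lambda>n. - int n - 1) ` {..<J}) + sum ?f (int ` {..<J})"
    by (rule sum.union_disjoint) auto
  also have "sum ?f ((\<lambda>n. - int n - 1) ` {..<J}) = (\<Sum>n<J. ?d (- int n - 1) (?e (int n - 2) v))"
    by (subst sum.reindex) (auto simp: inj_on_def)
  also have "sum ?f (int ` {..<J}) = (\<Sum>n<J. ?e (- int n - 3) (?d (int n) v))"
    by (subst sum.reindex) (auto simp: inj_on_def intro!: sum.cong arg_cong2[of _ _ _ _ ?e])
  finally show ?thesis
    unfolding deriv_heis_field_neg deriv_heis_field_nonneg by simp
qed

lemma exp_field_vac:
  "exp_field k s n (evec l) = (if - n - 1 - form_L k s l \<ge> 0
     then exp_creation k s (nat (- n - 1 - form_L k s l)) (evec (l + s)) else 0)"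
  by (subst exp_field_graded(1)[of _ _ 0 0 0]) (auto intro!: basis_in_graded)

section \<open>Translation\<close>

text \<open>The translation operator T on a monomial, computed from T e^m = m alpha(-1) e^m and
  [T, d_p] = d_(p+1). Lists are taken in order to follow the recursion of
  \<open>basis_field\<close>.\<close>

fun translate :: "int \<Rightarrow> nat list \<Rightarrow> VL" where
  "translate m [] = smult_VL (of_int m) (cre 0 (evec m))"
| "translate m (p # ps) = smult_VL (1 / fact p)
     (cre p (translate m ps) + cre (Suc p) (basis_vec (mset ps) m))"

lemma graded_length_0:
  assumes "v \<in> graded m W 0" "W \<noteq> 0"
  shows "v = 0"
proof -
  have "{basis_vec M m | M. int (wt M) = W \<and> int (size M) \<le> 0} = {}"
    using assms(2) by auto
  with assms(1) show ?thesis by (simp add: graded_def)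
qed

text \<open>The creation property: Y(a, z) 1 = a + z T(a) + higher powers of z. The claims are
  proved together because the modes -1 and -2 of a longer product reduce to single terms only when
  the nonnegative modes of the shorter one vanish.\<close>

lemma modes_on_vacuum:
  defines "B \<equiv> \<lambda>k m ps. foldr (\<lambda>p. normal_order (deriv_heis_field k p)) ps (exp_field k m)"
  shows "B k m ps n 0 = 0" "n \<ge> 0 \<Longrightarrow> B k m ps n (evec 0) = 0"
    "B k m ps (- 1) (evec 0) = basis_vec (mset ps) m" "B k m ps (- 2) (evec 0) = translate m ps"
proof (induction ps arbitrary: n)
  case Nil
  have form: "form_L k m 0 = 0"
    by (simp add: form_L_def)
  {
    case 1 show ?case by (simp add: B_def)
  next
    case 2 then show ?case by (simp add: B_def exp_field_vac form)
  next
    case 3 show ?case by (simp add: B_def exp_field_vac form)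
  next
    case 4
    have "exp_creation k m 1 (evec m) - smult_VL (of_int m) (basis_vec {#0#} m) = 0"
      by (rule graded_length_0[of _ m 1]) (use exp_creation_leading[of 1 k m m] in simp_all)
    then show ?case by (simp add: B_def exp_field_vac form cre_basis)
  }
next
  case (Cons p ps)
  let ?d = "deriv_heis_field k p"
  have B: "B k m (p # ps) n v = Sum_any (\<lambda>j. if j < 0 then ?d j (B k m ps (n - 1 - j) v)
      else B k m ps (n - 1 - j) (?d j v))" for n v
    unfolding B_def foldr.simps comp_def normal_order_def by (rule refl)
  have "?d j (evec 0) = 0" if "j \<ge> 0" for j
    using deriv_heis_field_nonneg[of k p "nat j" "evec 0"] that by (simp add: ann_vac)
  then have vac: "B k m (p # ps) n (evec 0) =
      Sum_any (\<lambda>j. if j < 0 then ?d j (B k m ps (n - 1 - j) (evec 0)) else 0)" for n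
    unfolding B by (intro Sum_any.cong) (simp add: Cons.IH(1))
  {
    case 1 show ?case unfolding B by (simp add: Cons.IH(1) cong: if_cong)
  next
    case 2 then show ?case unfolding vac by (subst Sum_any_superset[of "{}"]) (auto simp: Cons.IH(2))
  next
    case 3
    have "B k m (p # ps) (- 1) (evec 0) = ?d (- 1) (B k m ps (- 1) (evec 0))"
      unfolding vac by (subst Sum_any_superset[of "{- 1}"]) (auto simp: Cons.IH(2))
    then show ?case
      using deriv_heis_field_neg[of k p 0] by (simp add: Cons.IH(3) cre_basis)
  next
    case 4
    have "B k m (p # ps) (- 2) (evec 0) =
        ?d (- 1) (B k m ps (- 2) (evec 0)) + ?d (- 2) (B k m ps (- 1) (evec 0))"
      unfolding vac by (subst Sum_any_superset[of "{- 1, - 2}"]) (auto simp: Cons.IH(2))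
    then show ?case
      using deriv_heis_field_neg[of k p 0] deriv_heis_field_neg[of k p 1]
      by (simp add: Cons.IH(3,4) VL.scale_right_distrib)
  }
qed

lemma theta_translate: "theta (translate m ps) = smult_VL ((- 1) ^ length ps) (translate (- m) ps)"
proof (induction ps)
  case (Cons p ps)
  then show ?case
    by (simp add: theta_cre theta_basis VL.scale_right_distrib VL.scale_right_diff_distrib mult.commute)
qed (simp add: theta_cre theta_basis)

lemma translate_in_Uhat: "translate m (sorted_list_of_multiset M) \<in> Uhat k"
proof -
  let ?ps = "sorted_list_of_multiset M" and ?v = "basis_vec M m"
  have nprod: "nprod_VL k (basis_vec M m) (- 2) (evec 0) = translate m ?ps" for m
    using modes_on_vacuum(4)[where k = k and m = m and ps = ?ps] by (simp add: nprod_basis basis_field_def)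
  have "length ?ps = size M"
    by (metis mset_sorted_list_of_multiset size_mset)
  then have "nprod_VL k (?v + theta ?v) (- 2) (evec 0) = translate m ?ps + theta (translate m ?ps)"
    by (simp add: nprod_add nprod_scale nprod theta_basis theta_translate)
  moreover have "evec 0 \<in> VL_plus"
    by (simp add: VL_plus_def theta_basis)
  ultimately show ?thesis
    using nprod_in_C2[OF sym_in_VL_plus[of ?v], of "evec 0" k] by (simp add: Uhat_def)
qed

text \<open>Only T e^m creates a new factor, m d_0; the commutators [T, d_p] raise an index and keep
  the length.\<close>

lemma translate_leading:
  "translate m ps - smult_VL (of_int m) (cre 0 (basis_vec (mset ps) m))
    \<in> graded m (int (wt (mset ps)) + 1) (int (length ps))"
proof (induction ps)
  case (Cons p ps)
  have "basis_vec (add_mset p (mset ps)) m = smult_VL (1 / fact p) (cre p (basis_vec (mset ps) m))"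
    by (simp add: cre_basis)
  then have "translate m (p # ps) - smult_VL (of_int m) (cre 0 (basis_vec (mset (p # ps)) m)) =
      smult_VL (1 / fact p) (cre p (translate m ps - smult_VL (of_int m) (cre 0 (basis_vec (mset ps) m)))
        + cre (Suc p) (basis_vec (mset ps) m))"
    by (simp add: VL.scale_right_distrib VL.scale_right_diff_distrib cre_commute[of 0 p] mult.commute)
  moreover have "cre p (translate m ps - smult_VL (of_int m) (cre 0 (basis_vec (mset ps) m)))
      \<in> graded m (int (wt (mset (p # ps))) + 1) (int (length (p # ps)))"
    using cre_graded[OF Cons, of p] by (simp add: algebra_simps)
  moreover have "cre (Suc p) (basis_vec (mset ps) m)
      \<in> graded m (int (wt (mset (p # ps))) + 1) (int (length (p # ps)))"
    using cre_graded[OF basis_in_graded[OF refl order_refl], of "Suc p" "mset ps" m]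
    by (simp add: algebra_simps)
  ultimately show ?case
    by (simp only: VL.subspace_scale[OF subspace_graded] VL.subspace_add[OF subspace_graded])
qed (simp add: VL.subspace_0[OF subspace_graded])

lemma translation_relation:
  "\<exists>w \<in> graded m (int (wt M) + 1) (int (size M)). smult_VL (of_int m) (cre 0 (basis_vec M m)) + w \<in> Uhat k"
proof -
  let ?ps = "sorted_list_of_multiset M"
  have "length ?ps = size M"
    by (metis mset_sorted_list_of_multiset size_mset)
  then show ?thesis
    using translate_leading[of m ?ps] translate_in_Uhat[of m M k]
    by (intro bexI[of _ "translate m ?ps - smult_VL (of_int m) (cre 0 (basis_vec M m))"]) simp_all
qed

lemma translation_relation_cre:
  "smult_VL (of_int m) (cre 0 (cre n (evec m))) + cre (Suc n) (evec m) \<in> Uhat k"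
  using VL.subspace_scale[OF subspace_Uhat translate_in_Uhat[of m "{#n#}" k], of "fact n"]
  by (simp add: cre_commute[of n 0])

section \<open>Reduction of lengths\<close>

text \<open>Each leading relation moves one derivative from the first factor to the second and
  changes the sign. The subspace \<open>Z\<close> may exceed Uhat, so that the argument also applies
  modulo vectors of lower charge.\<close>

lemma pair_shift:
  assumes Z: "VL.subspace Z" "Uhat k \<subseteq> Z" and v: "v \<in> graded m W r"
    and less: "graded m (W + int (p + q) + 2) (r + 1) \<subseteq> Z"
  shows "cre p (cre q v) - smult_VL ((- 1) ^ p) (cre 0 (cre (p + q) v)) \<in> Z"
  using less
proof (induction p arbitrary: q)
  case 0
  then show ?case by (simp add: VL.subspace_0[OF Z(1)])
next
  case (Suc p)
  obtain w where w: "w \<in> graded m (W + int (p + q) + 3) (r + 1)"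
      and rel: "cre p (cre (Suc q) v) + cre (Suc p) (cre q v) + w \<in> Uhat k"
    using quad_leading[OF v] by blast
  have "w \<in> Z"
    using Suc.prems w by (auto simp: algebra_simps)
  with rel Z have "cre p (cre (Suc q) v) + cre (Suc p) (cre q v) + w - w \<in> Z"
    by (intro VL.subspace_diff) auto
  moreover have "cre p (cre (Suc q) v) - smult_VL ((- 1) ^ p) (cre 0 (cre (p + Suc q) v)) \<in> Z"
    using Suc.prems by (intro Suc.IH) (simp add: algebra_simps)
  ultimately have "cre p (cre (Suc q) v) + cre (Suc p) (cre q v) + w - w -
      (cre p (cre (Suc q) v) - smult_VL ((- 1) ^ p) (cre 0 (cre (p + Suc q) v))) \<in> Z"
    by (rule VL.subspace_diff[OF Z(1)])
  then show ?case by simp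
qed

lemma subspace_cancel_scale:
  assumes "VL.subspace Z" "smult_VL c v \<in> Z" "c \<noteq> 0"
  shows "v \<in> Z"
  using VL.subspace_scale[OF assms(1,2), of "1 / c"] assms(3) by simp

lemma subspace_cancel_add:
  assumes "VL.subspace Z" "v + w \<in> Z" "w \<in> Z"
  shows "v \<in> Z"
  using VL.subspace_diff[OF assms] by simp

lemma subspace_cancel_diff:
  assumes "VL.subspace Z" "v - w \<in> Z" "w \<in> Z"
  shows "v \<in> Z"
  using VL.subspace_add[OF assms] by simp

lemma basis_from_pair:
  assumes "VL.subspace Z" "cre p (cre q (basis_vec N m)) \<in> Z"
  shows "basis_vec (add_mset p (add_mset q N)) m \<in> Z"
  by (rule subspace_cancel_scale[OF assms(1), of "fact q * fact p"]) (use assms(2) in \<open>auto simp: cre_basis\<close>)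

text \<open>Two factors d_p d_q become d_0 d_(p+q) up to sign, and d_0 v is 1/m times a translate,
  both modulo shorter terms. So each length above one reduces to the next smaller one.\<close>

lemma charged_reduction:
  assumes Z: "VL.subspace Z" "Uhat k \<subseteq> Z" and m: "m \<noteq> 0" and base: "graded m W 1 \<subseteq> Z"
  shows "graded m W r \<subseteq> Z"
proof -
  have "graded m W (int n + 1) \<subseteq> Z" for n
  proof (induction n)
    case (Suc n)
    show ?case
    proof (rule graded_subset[OF Z(1)])
      fix M assume M: "int (wt M) = W" "int (size M) \<le> int (Suc n) + 1"
      show "basis_vec M m \<in> Z"
      proof (cases "size M \<le> n + 1")
        case True
        then show ?thesis
          using Suc basis_in_graded[OF M(1), of "int n + 1"] by auto
      next
        case False
        with M(2) have "size M = Suc (Suc n)"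
          by simp
        then obtain p q N where N: "M = add_mset p (add_mset q N)" "size N = n"
          by (metis size_eq_Suc_imp_eq_union size_add_mset nat.inject)
        have W: "int (wt N) + int (p + q) + 2 = W"
          using M(1) N(1) by simp
        obtain w where "w \<in> graded m W (int n + 1)"
          "smult_VL (of_int m) (cre 0 (basis_vec (add_mset (p + q) N) m)) + w \<in> Uhat k"
          using translation_relation[of m "add_mset (p + q) N" k] N(2) W by (auto simp: algebra_simps)
        then have "smult_VL (of_int m) (cre 0 (basis_vec (add_mset (p + q) N) m)) \<in> Z"
          using Suc Z by (blast intro: subspace_cancel_add)
        then have "cre 0 (basis_vec (add_mset (p + q) N) m) \<in> Z"
          by (rule subspace_cancel_scale[OF Z(1)]) (use m in simp)
        then have "smult_VL ((- 1) ^ p) (cre 0 (cre (p + q) (basis_vec N m))) \<in> Z"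
          by (simp add: cre_basis[of "p + q"] VL.subspace_scale[OF Z(1)])
        moreover have less: "graded m (int (wt N) + int (p + q) + 2) (int n + 1) \<subseteq> Z"
          unfolding W by (rule Suc)
        have "cre p (cre q (basis_vec N m)) -
            smult_VL ((- 1) ^ p) (cre 0 (cre (p + q) (basis_vec N m))) \<in> Z"
          by (rule pair_shift[OF Z basis_in_graded[OF refl] less]) (simp add: N(2))
        ultimately have "cre p (cre q (basis_vec N m)) \<in> Z"
          by (rule subspace_cancel_diff[OF Z(1), rotated])
        then show ?thesis
          unfolding N(1) by (rule basis_from_pair[OF Z(1)])
      qed
    qed
  qed (use base in simp)
  moreover have "r \<le> int (nat (r - 1)) + 1"
    by linarith
  ultimately show ?thesis
    using graded_mono by blast
qed

section \<open>Charge 0: odd lengths and quadratic monomials\<close>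

lemma odd_length_in_Uhat:
  assumes "odd (size M)"
  shows "basis_vec M 0 \<in> Uhat k"
proof -
  have "smult_VL 2 (basis_vec M 0) = basis_vec M 0 - theta (basis_vec M 0)"
    using assms VL.scale_left_distrib[of 1 1 "basis_vec M 0"] by (simp add: theta_basis)
  then have "smult_VL 2 (basis_vec M 0) \<in> Uhat k"
    using Uhat_minus_theta by metis
  then show ?thesis
    by (rule subspace_cancel_scale[OF subspace_Uhat]) simp
qed

text \<open>On the vacuum of charge 0 the alpha(0) term is zero, so the shift leaves no remainder,
  and the scalars of different relations can be compared.\<close>

lemma pair_shift_exact: "cre p (cre q (evec 0)) - smult_VL ((- 1) ^ p) (cre 0 (cre (p + q) (evec 0))) \<in> Uhat k"
proof (induction p arbitrary: q)
  case 0
  then show ?case by (simp add: VL.subspace_0[OF subspace_Uhat])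
next
  case (Suc p)
  have "cre p (cre (Suc q) (evec 0)) + cre (Suc p) (cre q (evec 0)) \<in> Uhat k"
    using rel0_in_Uhat[of k 0 p q] by (simp add: rel0_def)
  from VL.subspace_diff[OF subspace_Uhat this Suc.IH[of "Suc q"]] show ?case
    by simp
qed

text \<open>The two products have the same leading term of length four, so their difference is a multiple
  of the length two monomial.\<close>

lemma pair_in_Uhat:
  assumes "k > 0" "p + q \<ge> 8"
  shows "cre p (cre q (evec 0)) \<in> Uhat k"
proof -
  note U = subspace_Uhat[of k]
  let ?w = "\<lambda>n. cre 0 (cre n (evec 0))"
  have "?w n \<in> Uhat k" if n: "n \<ge> 8" for n
  proof (cases "even n")
    case False
    \<comment> \<open>d_n d_0 is congruent to (-1)^n d_0 d_n; for odd n the monomial is its own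
      negative.\<close>
    then have "smult_VL 2 (?w n) \<in> Uhat k"
      using pair_shift_exact[of n 0 k] VL.scale_left_distrib[of 1 1 "?w n"]
      by (simp add: cre_commute[of n 0])
    then show ?thesis
      by (rule subspace_cancel_scale[OF U]) simp
  next
    case True
    \<comment> \<open>The monomial d_0 d_1 d_2 d_s is the leading term both of the pair (0,0) acting
      on d_2 d_s and of (1,1) acting on d_0 d_s. A contraction raises the total index s + 3 by 2,
      which must give n.\<close>
    define s where "s = n - 5"
    then have s: "n = s + 5" "s \<ge> 3" "odd s"
      using n True by auto
    have rel: "rel0 k 0 0 0 = smult_VL 2 (cre 0 (cre 1 (evec 0)))"
        "rel0 k 0 1 1 = smult_VL 2 (cre 1 (cre 2 (evec 0)))"
      using VL.scale_left_distrib[of 1 1 "cre 0 (cre 1 (evec 0))"]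
        VL.scale_left_distrib[of 1 1 "cre 1 (cre 2 (evec 0))"]
      by (simp_all add: rel0_def cre_commute[of "Suc 0" 0] cre_commute[of "Suc (Suc 0)"] numeral_2_eq_2)
    let ?A = "cre 2 (cre (s + 3) (evec 0))" and ?B = "cre 5 (cre s (evec 0))"
    let ?L = "smult_VL 2 (cre 0 (cre 1 (cre 2 (cre s (evec 0)))))"
    have 1: "?L + smult_VL (contr k 0 0 s) ?A + smult_VL (contr k 0 0 2) ?B \<in> Uhat k"
      using rel2_in_Uhat[of 2 s k 0 0 0]
      by (simp add: rel cre_commute[of 2 0] cre_commute[of 2 1] cre_commute[of s 0]
          cre_commute[of s 1] cre_commute[of s "Suc 0"] cre_commute[of 2 "Suc 0"]
          cre_commute[of s 2] add.commute)
    have 2: "?L + smult_VL (contr k 1 1 s) (?w n) + smult_VL (contr k 1 1 0) ?B \<in> Uhat k"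
      using rel2_in_Uhat[of 0 s k 0 1 1] unfolding rel
      by (simp add: s(1) cre_commute[of s 1] cre_commute[of s "Suc 0"] cre_commute[of s 2] add.commute)
    have A: "?A - ?w n \<in> Uhat k"
      using pair_shift_exact[of 2 "s + 3" k] by (simp add: s(1) add.commute)
    have B: "?B + ?w n \<in> Uhat k"
      using pair_shift_exact[of 5 s k] by (simp add: s(1) add.commute)
    let ?c = "contr k 0 0 s - contr k 0 0 2 - contr k 1 1 s + contr k 1 1 0"
    have "(?L + smult_VL (contr k 0 0 s) ?A + smult_VL (contr k 0 0 2) ?B) -
        (?L + smult_VL (contr k 1 1 s) (?w n) + smult_VL (contr k 1 1 0) ?B) -
        smult_VL (contr k 0 0 s) (?A - ?w n) - smult_VL (contr k 0 0 2 - contr k 1 1 0) (?B + ?w n) \<in> Uhat k"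
      by (intro VL.subspace_diff[OF U] VL.subspace_scale[OF U] 1 2 A B)
    also have "(?L + smult_VL (contr k 0 0 s) ?A + smult_VL (contr k 0 0 2) ?B) -
        (?L + smult_VL (contr k 1 1 s) (?w n) + smult_VL (contr k 1 1 0) ?B) -
        smult_VL (contr k 0 0 s) (?A - ?w n) - smult_VL (contr k 0 0 2 - contr k 1 1 0) (?B + ?w n) =
        smult_VL ?c (?w n)"
      by (simp add: VL.scale_right_distrib VL.scale_right_diff_distrib VL.scale_left_distrib
          VL.scale_left_diff_distrib)
    finally have "smult_VL ?c (?w n) \<in> Uhat k" .
    \<comment> \<open>The scalar is 8k (1/((s+2)(s+4)) - 1/15). It vanishes at s = 1, i.e. n = 6, so
      even n must be at least 8.\<close>
    moreover have "?c \<noteq> 0"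
    proof -
      have "?c = of_real (8 * real k * (1 / (real (s + 2) * real (s + 4)) - 1 / 15))"
      proof -
        have "of_nat (s + 2) \<noteq> (0::complex)" "of_nat (s + 3) \<noteq> (0::complex)" "of_nat (s + 4) \<noteq> (0::complex)"
            "of_nat (45 + s * 15) \<noteq> (0::complex)"
          by (simp_all only: of_nat_eq_0_iff)
        then show ?thesis
          by (simp add: contr_def divide_simps) (simp add: algebra_simps)
      qed
      moreover have "real (s + 2) * real (s + 4) > 15"
      proof -
        have "real 5 * real 7 \<le> real (s + 2) * real (s + 4)"
          using s(2) by (intro mult_mono) auto
        then show ?thesis by simp
      qed
      then have "1 / (real (s + 2) * real (s + 4)) < 1 / 15"
        by (intro divide_strict_left_mono) auto
      ultimately show ?thesis
        using assms(1) by (simp only: of_real_eq_0_iff) simp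
    qed
    ultimately show ?thesis
      by (rule subspace_cancel_scale[OF U])
  qed
  from this[OF assms(2)] show ?thesis
    using subspace_cancel_diff[OF U pair_shift_exact] VL.subspace_scale[OF U] by blast
qed

section \<open>Positive charge: vectors of length one\<close>

definition zero_mode_real :: "nat \<Rightarrow> real" where
  "zero_mode_real q = (- 1) ^ q / (real (q + 1) * real (q + 2))"

lemma zero_mode_coeff_of_real: "zero_mode_coeff q = of_real (zero_mode_real q)"
  by (simp add: zero_mode_coeff_def zero_mode_real_def)

lemma abs_zero_mode_real_le:
  assumes "p \<le> q"
  shows "\<bar>zero_mode_real q\<bar> \<le> 1 / (real (p + 1))\<^sup>2"
proof -
  have "\<bar>zero_mode_real q\<bar> = 1 / (real (q + 1) * real (q + 2))"
    by (simp add: zero_mode_real_def abs_mult power_abs)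
  also have "\<dots> \<le> 1 / (real (p + 1))\<^sup>2"
    unfolding power2_eq_square using assms by (intro divide_left_mono mult_mono) auto
  finally show ?thesis .
qed

text \<open>The scalar in front of \<open>\<alpha>(-n-1) e\<^sup>m\<^sup>\<alpha>\<close>, divided by \<open>\<langle>\<alpha>, \<alpha>\<rangle> = 2k\<close>, is close to 4/15.\<close>

lemma loop_scalar_nonzero:
  fixes a b u w :: real
  assumes p: "p \<ge> 10 * k * m" "k > 0" "m > 0"
    and bounds: "\<bar>a\<bar> \<le> 1 / (real (p + 1))\<^sup>2" "\<bar>b\<bar> \<le> 1 / (real (p + 1))\<^sup>2"
      "\<bar>u\<bar> \<le> 1 / (real (p + 1))\<^sup>2" "\<bar>w\<bar> \<le> 1 / (real (p + 1))\<^sup>2"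
  shows "4 / 15 + 2 * (b - a) + 2 * real k * (real m)\<^sup>2 *
      (7 / 6 * a - b / 2 - u / 6 - w / 2 - u * b + 2 * u * a - w * a) \<noteq> 0"
proof -
  define e where "e = 1 / (real (p + 1))\<^sup>2"
  have km: "real k * real m \<ge> 1"
    using p(2,3) by (metis One_nat_def Suc_leI mult_pos_pos of_nat_1 of_nat_le_iff of_nat_mult)
  have "10 * (real k * real m) \<le> real (p + 1)"
    using p(1) by (metis (mono_tags, lifting) le_add1 le_trans mult.assoc of_nat_le_iff of_nat_mult of_nat_numeral)
  then have "(10 * (real k * real m))\<^sup>2 \<le> (real (p + 1))\<^sup>2"
    using km by (intro power_mono) auto
  then have e: "e \<le> 1 / (10 * (real k * real m))\<^sup>2"
    unfolding e_def using p(2,3) by (intro divide_left_mono) (auto intro!: mult_pos_pos)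
  have e0: "e \<ge> 0" by (simp add: e_def)
  have "1 / (10 * (real k * real m))\<^sup>2 \<le> 1 / 10\<^sup>2"
    using km p(2,3) by (intro divide_left_mono power_mono) auto
  with e have e1: "e \<le> 1 / 100"
    by simp
  \<comment> \<open>The correction carries a factor k m^2, while e is at most 1/(10km)^2; this is
    the purpose of p >= 10km.\<close>
  have kme: "real k * (real m)\<^sup>2 * e \<le> 1 / 100"
  proof -
    have "real k * (real m)\<^sup>2 * e \<le> real k * (real m)\<^sup>2 * (1 / (10 * (real k * real m))\<^sup>2)"
      using e by (intro mult_left_mono) auto
    also have "\<dots> = 1 / (100 * real k)"
      using p(2,3) by (simp add: power2_eq_square field_simps)
    also have "\<dots> \<le> 1 / 100"
      using p(2) by (simp add: field_simps)
    finally show ?thesis .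
  qed
  have prod: "\<bar>x * y\<bar> \<le> e / 100" if "\<bar>x\<bar> \<le> e" "\<bar>y\<bar> \<le> e" for x y
  proof -
    have "\<bar>x * y\<bar> \<le> e * (1 / 100)"
      unfolding abs_mult using that e1 e0 by (intro mult_mono) auto
    then show ?thesis by simp
  qed
  note bounds = bounds[folded e_def]
  \<comment> \<open>The linear coefficients have absolute sum 7/3 and the products contribute at
    most 4e/100, so 3e leaves room. In the end 4/15 is compared with 4e + 3/50, at most
    1/10.\<close>
  have "\<bar>7 / 6 * a - b / 2 - u / 6 - w / 2 - u * b + 2 * (u * a) - w * a\<bar> \<le> 3 * e"
    using bounds prod[OF bounds(3,2)] prod[OF bounds(3,1)] prod[OF bounds(4,1)] by linarith
  then have "\<bar>2 * real k * (real m)\<^sup>2 * (7 / 6 * a - b / 2 - u / 6 - w / 2 - u * b + 2 * (u * a) - w * a)\<bar>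
      \<le> 2 * real k * (real m)\<^sup>2 * (3 * e)"
    unfolding abs_mult by (intro mult_mono) auto
  also have "\<dots> \<le> 3 / 50"
    using kme by (simp add: mult_ac)
  finally have "\<bar>2 * real k * (real m)\<^sup>2 * (7 / 6 * a - b / 2 - u / 6 - w / 2 - u * b + 2 * (u * a) - w * a)\<bar> \<le> 3 / 50" .
  moreover have "4 / 15 + 2 * (b - a) + x \<noteq> 0" if "\<bar>x\<bar> \<le> 3 / 50" for x
  proof
    assume eq: "4 / 15 + 2 * (b - a) + x = 0"
    have "a \<le> e" "- b \<le> e" "- x \<le> 3 / 50"
      using that bounds(1,2) by (simp_all add: abs_le_iff)
    with eq e1 show False by (simp add: field_simps)
  qed
  ultimately have "4 / 15 + 2 * (b - a) + 2 * real k * (real m)\<^sup>2 *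
      (7 / 6 * a - b / 2 - u / 6 - w / 2 - u * b + 2 * (u * a) - w * a) \<noteq> 0"
    by blast
  then show ?thesis
    by (simp only: mult.assoc not_False_eq_True)
qed

text \<open>The contractions that depend on p cancel in pairs, with opposite signs (-1)^p and
  (-1)^(p+1); what remains is 4k (1/12 + 1/20).\<close>

lemma contr_loop:
  "contr k (p + 1) 0 1 + contr k p 0 2 - contr k (p + 1) 1 0 - contr k p 1 1 = of_nat k * 8 / 15"
proof -
  have "of_nat (p + 3) \<noteq> (0::complex)" "of_nat (p + 4) \<noteq> (0::complex)" "of_nat (p + 5) \<noteq> (0::complex)"
    by (simp_all only: of_nat_eq_0_iff)
  then show ?thesis
    by (simp add: contr_def add.commute field_simps)
qed

text \<open>Two ways of moving derivatives between three factors have the same leading terms; their difference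
  is a multiple of \<open>\<alpha>(-n-1) e\<^sup>m\<^sup>\<alpha>\<close>.\<close>

lemma single_in_Uhat:
  assumes k: "k > 0" and m: "m > 0" and n: "n \<ge> 10 * k * m + 5"
  shows "cre n (evec (int m)) \<in> Uhat k"
proof -
  note U = subspace_Uhat[of k]
  define p where "p = n - 5"
  have np: "n = p + 5" and p: "p \<ge> 10 * k * m"
    using n by (auto simp: p_def)
  let ?e = "evec (int m)" and ?\<delta> = "cre n (evec (int m))"
  let ?y = "\<lambda>i. cre i (cre (p + 4 - i) (evec (int m)))"
  define c :: complex where "c = 2 * of_nat k * of_nat m"
  define a b u w where "a = zero_mode_real p" "b = zero_mode_real (p + 1)" "u = zero_mode_real (p + 3)" "w = zero_mode_real (p + 2)"
  have f: "zero_mode_coeff p = of_real a" "zero_mode_coeff (p + 1) = of_real b" "zero_mode_coeff (p + 3) = of_real u"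
      "zero_mode_coeff (p + 2) = of_real w" "zero_mode_coeff 0 = 1 / 2" "zero_mode_coeff 1 = - 1 / 6"
    by (simp_all only: a_b_u_w_def zero_mode_coeff_of_real) (simp_all add: zero_mode_real_def)
  have rel0: "rel0 k (int m) i j = cre i (cre (Suc j) ?e) + cre (Suc i) (cre j ?e)
      + smult_VL (c * (zero_mode_coeff i + zero_mode_coeff j)) (cre (i + j + 2) ?e)" for i j
    by (simp add: rel0_def c_def)
  \<comment> \<open>Modulo Uhat each pair d_i d_(p+4-i) is the multiple \<open>a0\<close>,
    \<open>a1\<close>, \<open>a2\<close> of d_n e^m: \<open>a0\<close> from the translate of d_(p+4)
    e^m, the next two by moving one derivative with \<open>rel0\<close>. The numbers 1/2 and -1/6
    are \<open>zero_mode_coeff\<close> at 0 and 1.\<close>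
  define a0 a1 a2 :: complex where "a0 = - 1 / of_nat m" "a1 = - a0 - c * (1 / 2 + of_real u)"
    "a2 = - a1 - c * (- 1 / 6 + of_real w)"
  have m0: "of_nat m \<noteq> (0 :: complex)"
    using m by simp
  have y0: "?y 0 - smult_VL a0 ?\<delta> \<in> Uhat k"
  proof -
    have "Suc (p + 4) = n"
      by (simp add: np)
    then have "smult_VL (of_nat m) (?y 0) + ?\<delta> \<in> Uhat k"
      using translation_relation_cre[of "int m" "p + 4" k] by simp
    from VL.subspace_scale[OF U this, of "1 / of_nat m"] show ?thesis
      using m0 by (simp add: VL.scale_right_distrib a0_a1_a2_def(1))
  qed
  have y1: "?y 1 - smult_VL a1 ?\<delta> \<in> Uhat k"
  proof -
    have "rel0 k (int m) 0 (p + 3) - (?y 0 - smult_VL a0 ?\<delta>) \<in> Uhat k"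
      by (rule VL.subspace_diff[OF U rel0_in_Uhat y0])
    moreover have "rel0 k (int m) 0 (p + 3) - (?y 0 - smult_VL a0 ?\<delta>) = ?y 1 - smult_VL a1 ?\<delta>"
      unfolding rel0 f a0_a1_a2_def(2)
      by (simp add: np numeral_eq_Suc VL.scale_left_distrib VL.scale_left_diff_distrib)
    ultimately show ?thesis by simp
  qed
  have y2: "?y 2 - smult_VL a2 ?\<delta> \<in> Uhat k"
  proof -
    have "rel0 k (int m) 1 (p + 2) - (?y 1 - smult_VL a1 ?\<delta>) \<in> Uhat k"
      by (rule VL.subspace_diff[OF U rel0_in_Uhat y1])
    moreover have "rel0 k (int m) 1 (p + 2) - (?y 1 - smult_VL a1 ?\<delta>) = ?y 2 - smult_VL a2 ?\<delta>"
      unfolding rel0 f a0_a1_a2_def(3)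
      by (simp add: np numeral_eq_Suc VL.scale_left_distrib VL.scale_left_diff_distrib)
    ultimately show ?thesis by simp
  qed
  \<comment> \<open>The four relations below have leading terms t1+t2, t3+t4, t4+t2 and t3+t1, so A
    + B - C - D has none. In each of them one of the factors d_0, d_1, d_2 is a spectator of the
    quadratic mode.\<close>
  define t1 where "t1 = cre 1 (cre 1 (cre (p + 1) ?e))"
  define t2 where "t2 = cre 0 (cre 1 (cre (p + 2) ?e))"
  define t3 where "t3 = cre 1 (cre 2 (cre p ?e))"
  define t4 where "t4 = cre 0 (cre 2 (cre (p + 1) ?e))"
  have A: "t1 + t2 + smult_VL (c * (of_real b + 1 / 2)) (?y 1) + smult_VL (contr k (p + 1) 0 1) ?\<delta> \<in> Uhat k"
  proof -
    have "cre 1 (cre (p + 1) (cre 1 ?e)) = t1" "cre 1 (cre (p + 2) (cre 0 ?e)) = t2"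
      unfolding t1_def t2_def by (metis cre_commute)+
    then show ?thesis
      using rel1_in_Uhat[of 1 k "int m" "p + 1" 0] unfolding rel0 f np
      by (simp add: numeral_eq_Suc)
  qed
  have B: "t3 + t4 + smult_VL (c * (of_real a + 1 / 2)) (?y 2) + smult_VL (contr k p 0 2) ?\<delta> \<in> Uhat k"
  proof -
    have "cre 2 (cre p (cre 1 ?e)) = t3" "cre 2 (cre (p + 1) (cre 0 ?e)) = t4"
      unfolding t3_def t4_def by (metis cre_commute)+
    then show ?thesis
      using rel1_in_Uhat[of 2 k "int m" p 0] unfolding rel0 f np
      by (simp add: numeral_eq_Suc)
  qed
  have C: "t4 + t2 + smult_VL (c * (of_real b - 1 / 6)) (?y 0) + smult_VL (contr k (p + 1) 1 0) ?\<delta> \<in> Uhat k"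
  proof -
    have "cre 0 (cre (p + 1) (cre 2 ?e)) = t4" "cre 0 (cre (p + 2) (cre 1 ?e)) = t2"
      unfolding t2_def t4_def by (metis cre_commute)+
    then show ?thesis
      using rel1_in_Uhat[of 0 k "int m" "p + 1" 1] unfolding rel0 f np
      by (simp add: numeral_eq_Suc)
  qed
  have D: "t3 + t1 + smult_VL (c * (of_real a - 1 / 6)) (?y 1) + smult_VL (contr k p 1 1) ?\<delta> \<in> Uhat k"
  proof -
    have "cre 1 (cre p (cre 2 ?e)) = t3" "cre 1 (cre (p + 1) (cre 1 ?e)) = t1"
      unfolding t1_def t3_def by (metis cre_commute)+
    then show ?thesis
      using rel1_in_Uhat[of 1 k "int m" p 1] unfolding rel0 f np
      by (simp add: numeral_eq_Suc)
  qed
  define K where "K = c * (of_real b + 1 / 2) * a1 + c * (of_real a + 1 / 2) * a2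
      - c * (of_real b - 1 / 6) * a0 - c * (of_real a - 1 / 6) * a1 + of_nat k * 8 / 15"
  let ?A = "t1 + t2 + smult_VL (c * (of_real b + 1 / 2)) (?y 1) + smult_VL (contr k (p + 1) 0 1) ?\<delta>"
    and ?B = "t3 + t4 + smult_VL (c * (of_real a + 1 / 2)) (?y 2) + smult_VL (contr k p 0 2) ?\<delta>"
    and ?C = "t4 + t2 + smult_VL (c * (of_real b - 1 / 6)) (?y 0) + smult_VL (contr k (p + 1) 1 0) ?\<delta>"
    and ?D = "t3 + t1 + smult_VL (c * (of_real a - 1 / 6)) (?y 1) + smult_VL (contr k p 1 1) ?\<delta>"
    and ?z0 = "?y 0 - smult_VL a0 ?\<delta>" and ?z1 = "?y 1 - smult_VL a1 ?\<delta>" and ?z2 = "?y 2 - smult_VL a2 ?\<delta>"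
  have "?A + ?B - ?C - ?D - smult_VL (c * (of_real b + 1 / 2)) ?z1 - smult_VL (c * (of_real a + 1 / 2)) ?z2
      + smult_VL (c * (of_real b - 1 / 6)) ?z0 + smult_VL (c * (of_real a - 1 / 6)) ?z1 \<in> Uhat k"
    by (intro VL.subspace_diff[OF U] VL.subspace_add[OF U] VL.subspace_scale[OF U] A B C D y0 y1 y2)
  also have "?A + ?B - ?C - ?D - smult_VL (c * (of_real b + 1 / 2)) ?z1 - smult_VL (c * (of_real a + 1 / 2)) ?z2
      + smult_VL (c * (of_real b - 1 / 6)) ?z0 + smult_VL (c * (of_real a - 1 / 6)) ?z1 = smult_VL K ?\<delta>"
    unfolding K_def contr_loop[symmetric, of k p]
    by (simp only: VL.scale_right_diff_distrib VL.scale_left_diff_distrib VL.scale_left_distrib VL.scale_scale)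
      simp
  finally have "smult_VL K ?\<delta> \<in> Uhat k" .
  moreover have "K \<noteq> 0"
  proof -
    have "K = of_real (2 * real k * (4 / 15 + 2 * (b - a) + 2 * real k * (real m)\<^sup>2 *
      (7 / 6 * a - b / 2 - u / 6 - w / 2 - u * b + 2 * u * a - w * a)))"
      unfolding K_def a0_a1_a2_def c_def using m0 by (simp add: field_simps power2_eq_square)
    moreover have "4 / 15 + 2 * (b - a) + 2 * real k * (real m)\<^sup>2 *
      (7 / 6 * a - b / 2 - u / 6 - w / 2 - u * b + 2 * u * a - w * a) \<noteq> 0"
      unfolding a_b_u_w_def by (rule loop_scalar_nonzero[OF p k m]) (simp_all only: abs_zero_mode_real_le le_add1 order_refl)
    ultimately show ?thesis
      using k by (simp only: of_real_eq_0_iff) simp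
  qed
  ultimately show ?thesis
    by (rule subspace_cancel_scale[OF U])
qed

section \<open>Charged vectors\<close>

lemma graded_full: "graded m W r \<subseteq> graded m W W"
  by (rule graded_subset[OF subspace_graded]) (use size_le_wt in \<open>auto intro: basis_in_graded\<close>)

text \<open>A mode changes the full weight by k s^2 - n - 1; since \<open>wt\<close> ignores k l^2
  and k (l+s)^2, the cross term 2kls is subtracted. The length is bounded by the weight
  only.\<close>

lemma exp_field_in_graded:
  assumes "v \<in> graded l W r"
  shows "exp_field k s n v \<in> graded (l + s) (W - n - 1 - form_L k s l) (W - n - 1 - form_L k s l)"
proof -
  let ?c = "form_L k s l"
  have "exp_creation k s (nat (int j - n - 1 - ?c)) (exp_annihilation k s j (shift_charge s v))
      \<in> graded (l + s) (W - n - 1 - ?c) (W - n - 1 - ?c)" if j: "int j - n - 1 - ?c \<ge> 0" for j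
  proof -
    have "exp_annihilation k s j (shift_charge s v) \<in> graded (l + s) (W - int j) r"
      using exp_annihilation_graded[where t = j and k = k and s = s, OF shift_charge_graded[where s = s, OF assms]]
        shift_charge_graded[OF assms, of s] graded_mono[of "r - 1" r "l + s" "W - int j"]
      by (cases "j = 0") auto
    from exp_creation_graded[OF this, of k s "nat (int j - n - 1 - ?c)"] j
    have "exp_creation k s (nat (int j - n - 1 - ?c)) (exp_annihilation k s j (shift_charge s v))
        \<in> graded (l + s) (W - n - 1 - ?c) (r + int (nat (int j - n - 1 - ?c)))"
      by (simp add: algebra_simps)
    then show ?thesis
      using graded_full by blast
  qed
  then show ?thesis
    by (subst exp_field_graded(1)[OF assms, of "nat W"])
      (auto intro!: VL.subspace_sum subspace_graded simp: VL.subspace_0[OF subspace_graded])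
qed

lemma charged_mode_in_graded:
  assumes "v \<in> graded l W r"
  shows "charged_mode k p s v \<in>
    graded (l + s) (W + int p + 2 - form_L k s l) (W + int p + 2 - form_L k s l)"
proof -
  let ?c = "form_L k s l" let ?X = "W + int p + 2 - ?c"
  let ?J = "nat (\<bar>W\<bar> + int p + 3 + \<bar>?c\<bar>)"
  have expand: "charged_mode k p s v =
    (\<Sum>i<?J. smult_VL (1 / (fact p * fact i)) (cre (p + i) (exp_field k s (int i - 2) v))) +
    (\<Sum>j<?J. smult_VL (1 / fact p) (exp_field k s (- int j - 3) (ann k p j v)))"
  proof (rule charged_mode_expand)
    fix j assume "j \<ge> ?J"
    then show "ann k p j v = 0"
      by (intro ann_eq_0[OF assms]) linarith
  next
    fix i assume "i \<ge> ?J"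
    then show "exp_field k s (int i - 2) v = 0"
      by (intro graded_neg_zero[OF exp_field_in_graded[OF assms]]) linarith
  qed
  have "cre (p + i) (exp_field k s (int i - 2) v) \<in> graded (l + s) ?X ?X" for i
    using cre_graded[OF exp_field_in_graded[OF assms, of k s "int i - 2"], of "p + i"] graded_full
    by (auto simp: algebra_simps)
  moreover have "exp_field k s (- int j - 3) (ann k p j v) \<in> graded (l + s) ?X ?X" for j
    using exp_field_in_graded[OF ann_graded[OF assms, of k p j], of k s "- int j - 3"]
    by (simp add: algebra_simps)
  ultimately show ?thesis
    unfolding expand
    by (intro VL.subspace_add VL.subspace_sum VL.subspace_scale subspace_graded)
qed

text \<open>Once \<open>form_L k s l\<close> is at least 2, the modes i - 2 with i >= 0 of the
  exponential field kill e^l. So the creation half of the normal order disappears, and in the other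
  half only alpha(0), at j = p, acts nontrivially.\<close>

lemma charged_mode_vac:
  assumes "form_L k s l \<ge> 2"
  shows "charged_mode k p s (evec l) = smult_VL ((- 1) ^ p * (2 * of_nat k * of_int l))
    (exp_field k s (- int p - 3) (evec l))"
proof -
  have "charged_mode k p s (evec l) =
    (\<Sum>i<p + 1. smult_VL (1 / (fact p * fact i)) (cre (p + i) (exp_field k s (int i - 2) (evec l)))) +
    (\<Sum>j<p + 1. smult_VL (1 / fact p) (exp_field k s (- int j - 3) (ann k p j (evec l))))"
    by (rule charged_mode_expand) (use assms in \<open>auto simp: ann_vac exp_field_vac\<close>)
  also have "(\<Sum>i<p + 1. smult_VL (1 / (fact p * fact i)) (cre (p + i) (exp_field k s (int i - 2) (evec l)))) = 0"
    by (rule sum.neutral) (use assms in \<open>auto simp: exp_field_vac\<close>)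
  also have "(\<Sum>j<p + 1. smult_VL (1 / fact p) (exp_field k s (- int j - 3) (ann k p j (evec l)))) =
      smult_VL ((- 1) ^ p * (2 * of_nat k * of_int l)) (exp_field k s (- int p - 3) (evec l))"
    by (simp add: ann_vac)
  finally show ?thesis by simp
qed

text \<open>Annihilation of degree 0 leaves d_n e^(l+s) alone, degree n + 1 contracts it to a
  multiple of e^(l+s), and the degrees between would give length 0 with positive weight. Under the
  modes i - 2 even the weight becomes negative, by the bound n + 3.\<close>

lemma exp_field_cre_vac:
  assumes "form_L k s l \<ge> int n + 3"
  shows "i \<ge> 0 \<Longrightarrow> exp_field k s (int i - 2) (cre n (evec l)) = 0"
    and "\<exists>d t. exp_field k s x (cre n (evec l)) =
      (if - x - 1 - form_L k s l \<ge> 0 then exp_creation k s (nat (- x - 1 - form_L k s l)) (cre n (evec (l + s))) else 0)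
      + smult_VL d (exp_creation k s t (evec (l + s)))"
proof -
  let ?c = "form_L k s l"
  have v: "cre n (evec l) \<in> graded l (int n + 1) 1"
    using cre_graded[OF basis_in_graded[of "{#}" 0 0], of n l] by simp
  show "i \<ge> 0 \<Longrightarrow> exp_field k s (int i - 2) (cre n (evec l)) = 0"
    using assms by (intro graded_neg_zero[OF exp_field_in_graded[OF v]]) auto
  have shift: "shift_charge s (cre n (evec l)) = cre n (evec (l + s))"
    by (simp add: cre_basis)
  let ?a = "\<lambda>j. exp_annihilation k s j (cre n (evec (l + s)))"
  let ?f = "\<lambda>j. if int j - x - 1 - ?c \<ge> 0 then exp_creation k s (nat (int j - x - 1 - ?c)) (?a j) else 0"
  have a: "?a j \<in> graded (l + s) (int n + 1 - int j) 0" if "j > 0" for j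
    using exp_annihilation_graded[where k = k and s = s, OF shift_charge_graded[where s = s, OF v] that] by (simp add: shift)
  have zero: "?f j = 0" if "0 < j" "j \<le> n" for j
    using graded_length_0[OF a[OF that(1)]] that(2) by auto
  have "{basis_vec M (l + s) | M. int (wt M) = 0 \<and> int (size M) \<le> 0} \<subseteq> {evec (l + s)}"
    by auto
  then have "graded (l + s) 0 0 \<subseteq> VL.span {evec (l + s)}"
    unfolding graded_def by (rule VL.span_mono)
  with a[of "Suc n"] obtain d where d: "?a (Suc n) = smult_VL d (evec (l + s))"
    by (auto simp: VL.span_singleton)
  have "exp_field k s x (cre n (evec l)) = (\<Sum>j\<le>Suc n. ?f j)"
    unfolding shift[symmetric] by (rule exp_field_graded(1)[OF v]) simp
  also have "\<dots> = ?f 0 + (\<Sum>j\<le>n. ?f (Suc j))"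
    by (rule sum.atMost_Suc_shift)
  also have "(\<Sum>j\<le>n. ?f (Suc j)) = (\<Sum>j<n. ?f (Suc j)) + ?f (Suc n)"
    by (simp add: lessThan_Suc_atMost[symmetric])
  also have "(\<Sum>j<n. ?f (Suc j)) = 0"
    by (intro sum.neutral ballI zero) auto
  finally have sum: "exp_field k s x (cre n (evec l)) = ?f 0 + ?f (Suc n)"
    by simp
  have "\<exists>d t. ?f (Suc n) = smult_VL d (exp_creation k s t (evec (l + s)))"
  proof (cases "int (Suc n) - x - 1 - ?c \<ge> 0")
    case True
    then show ?thesis by (auto simp: d)
  next
    case False
    then show ?thesis by (intro exI[of _ 0]) simp
  qed
  then obtain d t where dt: "?f (Suc n) = smult_VL d (exp_creation k s t (evec (l + s)))"
    by blast
  have zeroth: "?f 0 = (if - x - 1 - ?c \<ge> 0 then exp_creation k s (nat (- x - 1 - ?c)) (cre n (evec (l + s))) else 0)"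
    by simp
  show "\<exists>d t. exp_field k s x (cre n (evec l)) =
      (if - x - 1 - ?c \<ge> 0 then exp_creation k s (nat (- x - 1 - ?c)) (cre n (evec (l + s))) else 0)
      + smult_VL d (exp_creation k s t (evec (l + s)))"
    unfolding sum dt zeroth by blast
qed

text \<open>With this p the alpha(0) term has creation degree 0, where the exponential is the
  identity, so d_n e^(l+s) itself appears. All contracted terms are creation exponentials applied to
  e^(l+s).\<close>

lemma charged_mode_cre:
  assumes "form_L k s l \<ge> int n + 3" "int p = form_L k s l - 2"
  shows "charged_mode k p s (cre n (evec l)) -
      smult_VL ((- 1) ^ p * (2 * of_nat k * of_int l)) (cre n (evec (l + s)))
    \<in> VL.span (range (\<lambda>t. exp_creation k s t (evec (l + s))))" (is "_ \<in> ?P")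
proof -
  let ?J = "p + n + 2" and ?v = "cre n (evec l)"
  let ?f = "\<lambda>j. smult_VL (1 / fact p) (exp_field k s (- int j - 3) (ann k p j ?v))"
  have P: "VL.subspace ?P"
    by (rule VL.subspace_span)
  have creation: "exp_creation k s t (evec (l + s)) \<in> ?P" for t
    by (rule VL.span_base) auto
  have "charged_mode k p s ?v =
    (\<Sum>i<?J. smult_VL (1 / (fact p * fact i)) (cre (p + i) (exp_field k s (int i - 2) ?v))) + sum ?f {..<?J}"
    by (rule charged_mode_expand)
      (use exp_field_cre_vac(1)[OF assms(1)] in \<open>auto intro!: ann_cre_0 ann_vac_0\<close>)
  also have "(\<Sum>i<?J. smult_VL (1 / (fact p * fact i)) (cre (p + i) (exp_field k s (int i - 2) ?v))) = 0"
    by (rule sum.neutral) (simp add: exp_field_cre_vac(1)[OF assms(1)])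
  also have "sum ?f {..<?J} = ?f p + sum ?f ({..<?J} - {p})"
    by (rule sum.remove) auto
  finally have 1: "charged_mode k p s ?v = ?f p + sum ?f ({..<?J} - {p})"
    by simp
  have "?f j \<in> ?P" if "j \<noteq> p" for j
    using that creation[of "nat (int j + 2 - form_L k s l)"]
    by (auto simp: ann_cre ann_vac exp_field_vac VL.subspace_0[OF P] intro!: VL.subspace_scale[OF P] creation)
  then have 2: "sum ?f ({..<?J} - {p}) \<in> ?P"
    by (intro VL.subspace_sum[OF P]) auto
  have "?f p = smult_VL ((- 1) ^ p * (2 * of_nat k * of_int l)) (exp_field k s (- int p - 3) ?v)"
    by (simp add: ann_cre ann_vac)
  moreover obtain d t where "exp_field k s (- int p - 3) ?v =
      cre n (evec (l + s)) + smult_VL d (exp_creation k s t (evec (l + s)))"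
    using exp_field_cre_vac(2)[OF assms(1), of "- int p - 3"] assms(2) by auto
  ultimately have "?f p = smult_VL ((- 1) ^ p * (2 * of_nat k * of_int l)) (cre n (evec (l + s))) +
      smult_VL ((- 1) ^ p * (2 * of_nat k * of_int l) * d) (exp_creation k s t (evec (l + s)))"
    by (simp add: VL.scale_right_distrib)
  then have 3: "?f p - smult_VL ((- 1) ^ p * (2 * of_nat k * of_int l)) (cre n (evec (l + s))) \<in> ?P"
    using VL.subspace_scale[OF P creation] by simp
  show ?thesis
    unfolding 1 using VL.subspace_add[OF P 3 2] by (simp add: algebra_simps)
qed

section \<open>Reduction of charges above 20\<close>

definition low_charge :: "nat \<Rightarrow> int \<Rightarrow> VL set" where
  "low_charge k m = VL.span (Uhat k \<union> {basis_vec M l | M l. \<bar>l\<bar> < m})"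

lemma low_charge_props:
  "VL.subspace (low_charge k m)" "Uhat k \<subseteq> low_charge k m"
  "\<bar>l\<bar> < m \<Longrightarrow> graded l W r \<subseteq> low_charge k m"
proof -
  show sub: "VL.subspace (low_charge k m)"
    by (simp add: low_charge_def)
  show "Uhat k \<subseteq> low_charge k m"
    unfolding low_charge_def by (auto intro: VL.span_base)
  show "graded l W r \<subseteq> low_charge k m" if "\<bar>l\<bar> < m"
    by (rule graded_subset[OF sub]) (use that in \<open>auto simp: low_charge_def intro!: VL.span_base\<close>)
qed

text \<open>The charge 10 is chosen large enough for \<open>\<langle>10\<alpha>, (m-10)\<alpha>\<rangle>\<close> to exceed the bound in
  \<open>single_in_Uhat\<close>, so that the two arguments together cover all \<open>n\<close>.\<close>

lemma high_charge:
  assumes k: "k > 0" and m: "m \<ge> 21"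
  shows "basis_vec M (int m) \<in> low_charge k (int m)"
proof -
  let ?Z = "low_charge k (int m)" and ?l = "int m - 10"
  define c where "c = form_L k 10 ?l"
  note Z = low_charge_props(1)[of k "int m"] low_charge_props(2)[of k "int m"]
  have l: "?l + 10 = int m" "?l + - 10 = int m - 20" "\<bar>int m - 20\<bar> < int m" "of_int ?l \<noteq> (0::complex)"
    using m by (simp_all only: of_int_eq_0_iff)
  \<comment> \<open>Here 8 = 5 + 3: every n below 10km + 5 must satisfy n + 3 <= c for
    \<open>charged_mode_cre\<close>.\<close>
  have c: "c \<ge> 10 * int k * int m + 8"
  proof -
    have "int k * (int m - 20) \<ge> 1 * 1"
      using k m by (intro mult_mono) auto
    then show ?thesis
      by (simp add: c_def form_L_def algebra_simps)
  qed
  then have c2: "c \<ge> 2"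
    by (smt (verit) mult_nonneg_nonneg of_nat_0_le_iff)
  have first: "charged_mode k p 10 v \<in> ?Z" if "v \<in> graded ?l W r" for p v W r
  proof (rule subspace_cancel_diff[OF Z(1)])
    show "charged_mode k p 10 v - charged_mode k p (- 10) v \<in> ?Z"
      using charged_mode_in_Uhat Z(2) by blast
    show "charged_mode k p (- 10) v \<in> ?Z"
      using charged_mode_in_graded[OF that, of k p "- 10"] low_charge_props(3)[OF l(3)] by (auto simp: l)
  qed
  have creation: "exp_creation k 10 t (evec (int m)) \<in> ?Z" for t
  proof -
    \<comment> \<open>The alpha(0) term has creation degree p + 2 - c, which this choice makes equal
      to t.\<close>
    let ?p = "nat (c - 2) + t"
    have "smult_VL ((- 1) ^ ?p * (2 * of_nat k * of_int ?l)) (exp_field k 10 (- int ?p - 3) (evec ?l)) \<in> ?Z"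
      using first[OF basis_in_graded[OF refl order_refl], of ?p "{#}"] charged_mode_vac[of k 10 ?l ?p] c2
      by (simp add: c_def)
    then have "exp_field k 10 (- int ?p - 3) (evec ?l) \<in> ?Z"
      by (rule subspace_cancel_scale[OF Z(1)]) (use k l in simp)
    moreover have "exp_field k 10 (- int ?p - 3) (evec ?l) = exp_creation k 10 t (evec (int m))"
      using c2 by (simp add: exp_field_vac flip: c_def)
    ultimately show ?thesis by simp
  qed
  have single: "cre n (evec (int m)) \<in> ?Z" for n
  proof (cases "n \<ge> 10 * k * m + 5")
    case True
    then show ?thesis
      using single_in_Uhat[of k m n] k m Z(2) by auto
  next
    case False
    then have "int n < 10 * int k * int m + 5"
      by (metis int_ops(5,7) not_le of_nat_less_iff of_nat_numeral)
    with c have n: "c \<ge> int n + 3"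
      by simp
    let ?p = "nat (c - 2)"
    let ?s = "smult_VL ((- 1) ^ ?p * (2 * of_nat k * of_int ?l)) (cre n (evec (int m)))"
    have "charged_mode k ?p 10 (cre n (evec ?l)) - ?s \<in> ?Z"
    proof -
      have "charged_mode k ?p 10 (cre n (evec ?l)) - ?s
          \<in> VL.span (range (\<lambda>t. exp_creation k 10 t (evec (int m))))"
        using charged_mode_cre[of n k 10 ?l ?p] n c2 by (simp add: c_def[symmetric] l)
      also have "\<dots> \<subseteq> ?Z"
        by (rule VL.span_minimal[OF _ Z(1)]) (use creation in auto)
      finally show ?thesis .
    qed
    moreover have "charged_mode k ?p 10 (cre n (evec ?l)) \<in> ?Z"
      by (rule first[OF cre_graded[OF basis_in_graded[OF refl order_refl]]])
    ultimately have "charged_mode k ?p 10 (cre n (evec ?l)) - (charged_mode k ?p 10 (cre n (evec ?l)) - ?s) \<in> ?Z"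
      using VL.subspace_diff[OF Z(1)] by blast
    then have "?s \<in> ?Z"
      by simp
    then show ?thesis
      by (rule subspace_cancel_scale[OF Z(1)]) (use k l in simp)
  qed
  have "graded (int m) W 1 \<subseteq> ?Z" for W
  proof (rule graded_subset[OF Z(1)])
    fix N :: "nat multiset"
    assume "int (size N) \<le> 1"
    then consider "N = {#}" | n where "N = {#n#}"
      by (metis One_nat_def le_SucE le_zero_eq of_nat_1 of_nat_le_iff size_1_singleton_mset size_eq_0_iff_empty)
    then show "basis_vec N (int m) \<in> ?Z"
    proof cases
      case 1
      then show ?thesis using creation[of 0] by simp
    next
      case 2
      show ?thesis
        by (rule subspace_cancel_scale[OF Z(1), of "fact n"]) (use single[of n] 2 in \<open>simp_all add: cre_basis\<close>)
    qed
  qed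
  then have "graded (int m) (int (wt M)) (int (size M)) \<subseteq> ?Z"
    by (rule charged_reduction[OF Z, rotated]) (use m in simp)
  then show ?thesis
    using basis_in_graded[OF refl order_refl] by blast
qed

section \<open>Vectors of large weight\<close>

lemma charged_large_weight:
  assumes k: "k > 0" and m: "m > 0" and W: "W \<ge> int (10 * k * m + 6)"
  shows "graded (int m) W r \<subseteq> Uhat k"
proof (rule charged_reduction[OF subspace_Uhat order_refl])
  show "graded (int m) W 1 \<subseteq> Uhat k"
  proof (rule graded_subset[OF subspace_Uhat])
    fix N assume N: "int (wt N) = W" "int (size N) \<le> 1"
    have wt: "10 * k * m + 6 \<le> wt N"
      using N(1) W by (metis of_nat_le_iff)
    then have "N \<noteq> {#}"
      by auto
    then obtain n where n: "N = {#n#}"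
      using N(2) by (metis One_nat_def le_SucE le_zero_eq of_nat_1 of_nat_le_iff
          size_1_singleton_mset size_eq_0_iff_empty)
    have "cre n (evec (int m)) \<in> Uhat k"
      using wt n by (intro single_in_Uhat[OF k m]) simp
    then show "basis_vec N (int m) \<in> Uhat k"
      unfolding n cre_basis by (rule subspace_cancel_scale[OF subspace_Uhat]) simp
  qed
qed (use m in simp)

lemma negative_charge:
  assumes "basis_vec M (- m) \<in> Uhat k"
  shows "basis_vec M m \<in> Uhat k"
proof (rule subspace_cancel_diff[OF subspace_Uhat Uhat_minus_theta])
  show "theta (basis_vec M m) \<in> Uhat k"
    using assms by (simp add: theta_basis VL.subspace_scale[OF subspace_Uhat])
qed

text \<open>The alpha(0) term of the mode is the creation exponential of degree W, whose longest
  monomial is alpha(-1)^W. Every other term contains a factor d_(p+i) with p >= 1 and is therefore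
  shorter than its weight W.\<close>

lemma power_of_alpha:
  assumes k: "k > 0" and W: "W \<ge> 2 * k + 3"
    and charge2: "\<And>M. int (wt M) = int W - 4 * int k \<Longrightarrow> basis_vec M 2 \<in> Uhat k"
  shows "\<exists>w \<in> graded 0 (int W) (int W - 1). basis_vec (replicate_mset W 0) 0 + w \<in> Uhat k"
proof -
  \<comment> \<open>Since alpha pairs with -alpha to -2k, the alpha(0) term has creation degree p +
    2 + 2k.\<close>
  define p where "p = W - 2 * k - 2"
  have p: "W = p + 2 * k + 2" "p \<ge> 1"
    using W by (auto simp: p_def)
  let ?v = "evec (- 1)" and ?G = "graded 0 (int W) (int W - 1)" and ?J = "p + 2 * k + 2"
  have "charged_mode k p (- 1) ?v \<in> graded (- 2) (int W - 4 * int k) (int W - 4 * int k)"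
    using charged_mode_in_graded[OF basis_in_graded[OF refl order_refl], of k p "- 1" "{#}" "- 1"]
    by (simp add: form_L_def p algebra_simps)
  also have "\<dots> \<subseteq> Uhat k"
    by (rule graded_subset[OF subspace_Uhat]) (rule negative_charge, simp add: charge2)
  finally have in_Uhat: "charged_mode k p 1 ?v \<in> Uhat k"
    using charged_mode_in_Uhat[of k p 1 ?v] by (blast intro: subspace_cancel_diff[OF subspace_Uhat])
  have expand: "charged_mode k p 1 ?v =
    (\<Sum>i<?J. smult_VL (1 / (fact p * fact i)) (cre (p + i) (exp_field k 1 (int i - 2) ?v))) +
    (\<Sum>j<?J. smult_VL (1 / fact p) (exp_field k 1 (- int j - 3) (ann k p j ?v)))"
    by (rule charged_mode_expand) (auto simp: ann_vac exp_field_vac form_L_def)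
  have top: "(\<Sum>j<?J. smult_VL (1 / fact p) (exp_field k 1 (- int j - 3) (ann k p j ?v))) =
      smult_VL ((- 1) ^ p * (- 2 * of_nat k)) (exp_creation k 1 W (evec 0))"
  proof -
    have "(\<Sum>j<?J. smult_VL (1 / fact p) (exp_field k 1 (- int j - 3) (ann k p j ?v))) =
        (\<Sum>j<?J. if j = p then smult_VL ((- 1) ^ p * (- 2 * of_nat k)) (exp_creation k 1 W (evec 0)) else 0)"
    proof (rule sum.cong[OF refl])
      fix j
      have "nat (- (- int p - 3) - 1 - form_L k 1 (- 1)) = W"
        by (simp add: form_L_def p)
      then show "smult_VL (1 / fact p) (exp_field k 1 (- int j - 3) (ann k p j ?v)) =
          (if j = p then smult_VL ((- 1) ^ p * (- 2 * of_nat k)) (exp_creation k 1 W (evec 0)) else 0)"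
        by (simp add: ann_vac exp_field_vac lin_uminus[OF lin_exp_field]) (simp add: form_L_def)
    qed
    then show ?thesis by simp
  qed
  have rest: "(\<Sum>i<?J. smult_VL (1 / (fact p * fact i)) (cre (p + i) (exp_field k 1 (int i - 2) ?v))) \<in> ?G"
  proof (intro VL.subspace_sum VL.subspace_scale subspace_graded)
    fix i
    have X: "exp_field k 1 (int i - 2) ?v \<in> graded 0 (2 * int k + 1 - int i) (2 * int k + 1 - int i)"
      using exp_field_in_graded[OF basis_in_graded[OF refl order_refl], of k 1 "int i - 2" "{#}" "- 1"]
      by (simp add: form_L_def algebra_simps)
    have "cre (p + i) (exp_field k 1 (int i - 2) ?v) \<in> graded 0 (int W) (2 * int k + 1 - int i + 1)"
      using cre_graded[OF X, of "p + i"] by (simp add: p algebra_simps)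
    then show "cre (p + i) (exp_field k 1 (int i - 2) ?v) \<in> ?G"
      using graded_mono[of "2 * int k + 1 - int i + 1" "int W - 1" 0 "int W"] p by auto
  qed
  obtain w where w: "w \<in> ?G"
    "w + smult_VL ((- 1) ^ p * (- 2 * of_nat k)) (exp_creation k 1 W (evec 0)) \<in> Uhat k"
    using rest in_Uhat unfolding expand top by blast
  let ?x = "basis_vec (replicate_mset W 0) 0"
  define z where "z = exp_creation k 1 W (evec 0) - smult_VL (1 / fact W) ?x"
  have z: "z \<in> ?G"
    using exp_creation_leading[of W k 1 0] W by (simp add: z_def)
  define a where "a = (- 1) ^ p * (- 2 * of_nat k) * (1 / fact W :: complex)"
  have a: "a \<noteq> 0"
    using k by (simp add: a_def)
  have "w + smult_VL ((- 1) ^ p * (- 2 * of_nat k)) (exp_creation k 1 W (evec 0)) =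
      smult_VL a ?x + (w + smult_VL ((- 1) ^ p * (- 2 * of_nat k)) z)"
    by (simp add: z_def a_def VL.scale_right_diff_distrib)
  with w(2) have "smult_VL (1 / a) (smult_VL a ?x + (w + smult_VL ((- 1) ^ p * (- 2 * of_nat k)) z)) \<in> Uhat k"
    using VL.subspace_scale[OF subspace_Uhat] by metis
  then have "?x + smult_VL (1 / a) (w + smult_VL ((- 1) ^ p * (- 2 * of_nat k)) z) \<in> Uhat k"
    using a by (simp add: VL.scale_right_distrib)
  moreover have "smult_VL (1 / a) (w + smult_VL ((- 1) ^ p * (- 2 * of_nat k)) z) \<in> ?G"
    by (intro VL.subspace_scale VL.subspace_add subspace_graded w(1) z)
  ultimately show ?thesis by blast
qed

text \<open>Modulo shorter terms d_1 d_0 d_n is the negative of d_0 d_1 d_n, so this monomial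
  vanishes. Shifting through the pair (1,n) then kills d_0 d_0 d_(n+1), to which every triple of the
  same total index reduces.\<close>

lemma triple_in_Uhat:
  assumes u: "u \<in> graded 0 W' r" and sum: "p + q + s > 0"
    and less: "graded 0 (W' + int (p + q + s) + 3) (r + 2) \<subseteq> Uhat k"
  shows "cre p (cre q (cre s u)) \<in> Uhat k"
proof -
  note U = subspace_Uhat[of k]
  have shift: "cre p (cre q (cre s u)) - smult_VL ((- 1) ^ p) (cre 0 (cre (p + q) (cre s u))) \<in> Uhat k"
    if "graded 0 (W' + int (p + q + s) + 3) (r + 2) \<subseteq> Uhat k" for p q s
  proof -
    have eq: "W' + int s + 1 + int (p + q) + 2 = W' + int (p + q + s) + 3" "r + 1 + 1 = r + 2"
      by simp_all
    show ?thesis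
      by (rule pair_shift[OF U order_refl cre_graded[OF u]]) (use that in \<open>simp only: eq\<close>)
  qed
  define n where "n = p + q + s - 1"
  have n: "p + q + s = Suc n"
    using sum by (simp add: n_def)
  have less': "graded 0 (W' + int (i + j + l) + 3) (r + 2) \<subseteq> Uhat k" if "i + j + l = Suc n" for i j l
    using less unfolding n that .
  have "cre 1 (cre 0 (cre n u)) - smult_VL (- 1) (cre 0 (cre 1 (cre n u))) \<in> Uhat k"
    using shift[OF less', of 1 0 n] by simp
  then have "smult_VL 2 (cre 0 (cre 1 (cre n u))) \<in> Uhat k"
    using VL.scale_left_distrib[of 1 1 "cre 0 (cre 1 (cre n u))"] by (simp add: cre_commute[of 1 0] cre_commute[of "Suc 0" 0])
  then have zero: "cre 0 (cre 1 (cre n u)) \<in> Uhat k"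
    by (rule subspace_cancel_scale[OF U]) simp
  have "cre 1 (cre n (cre 0 u)) - smult_VL (- 1) (cre 0 (cre (Suc n) (cre 0 u))) \<in> Uhat k"
    using shift[OF less', of 1 n 0] by simp
  then have "cre 0 (cre 1 (cre n u)) + cre 0 (cre 0 (cre (Suc n) u)) \<in> Uhat k"
    by (simp add: cre_commute[of n 0] cre_commute[of "Suc n" 0] cre_commute[of "Suc 0" 0])
  with zero have zero': "cre 0 (cre 0 (cre (Suc n) u)) \<in> Uhat k"
    using subspace_cancel_add[OF U, of "cre 0 (cre 0 (cre (Suc n) u))" "cre 0 (cre 1 (cre n u))"]
    by (simp add: add.commute)
  have "cre (p + q) (cre s (cre 0 u)) - smult_VL ((- 1) ^ (p + q)) (cre 0 (cre (p + q + s) (cre 0 u))) \<in> Uhat k"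
    using shift[OF less', of "p + q" s 0] n by simp
  then have "cre 0 (cre (p + q) (cre s u)) - smult_VL ((- 1) ^ (p + q)) (cre 0 (cre 0 (cre (Suc n) u))) \<in> Uhat k"
    by (simp add: n cre_commute[of s 0] cre_commute[of "p + q" 0] cre_commute[of "Suc n" 0])
  then have "cre 0 (cre (p + q) (cre s u)) \<in> Uhat k"
    by (rule subspace_cancel_diff[OF U]) (rule VL.subspace_scale[OF U zero'])
  then show ?thesis
    by (intro subspace_cancel_diff[OF U shift[OF less]] VL.subspace_scale[OF U])
qed

lemma neutral_large_weight:
  assumes k: "k > 0" and W: "W \<ge> 204 * k + 16"
  shows "int (wt M) = int W \<Longrightarrow> basis_vec M 0 \<in> Uhat k"
proof (induction "size M" arbitrary: M rule: less_induct)
  case less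
  have U: "VL.subspace (Uhat k)"
    by (rule subspace_Uhat)
  have IH: "graded 0 (int W) r \<subseteq> Uhat k" if "r < int (size M)" for r
    by (rule graded_subset[OF U]) (use less.hyps that in auto)
  consider "size M \<le> 1" | "size M = 2" | "size M \<ge> 3" "\<forall>p\<in>#M. p = 0" | "size M \<ge> 3" "\<exists>p\<in>#M. p > 0"
    by force
  then show ?case
  proof cases
    case 1
    moreover have "size M \<noteq> 0"
      using less.prems W by auto
    ultimately show ?thesis
      by (intro odd_length_in_Uhat) (simp add: le_Suc_eq)
  next
    case 2
    then obtain p q where M: "M = {#p, q#}"
      by (metis One_nat_def Suc_1 size_1_singleton_mset size_eq_Suc_imp_eq_union size_add_mset nat.inject)
    then have "cre p (cre q (evec 0)) \<in> Uhat k"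
      using less.prems W by (intro pair_in_Uhat[OF k]) simp
    then show ?thesis
      unfolding M by (rule basis_from_pair[OF U])
  next
    case 3
    then have M: "M = replicate_mset (size M) 0"
      by (metis set_mset_subset_singletonD singleton_iff subsetI)
    have wt0: "wt (replicate_mset n 0) = n" for n
      by (induction n) auto
    have size: "size M = W"
      using less.prems M wt0 by (metis of_nat_eq_iff)
    have "\<exists>w \<in> graded 0 (int W) (int W - 1). basis_vec (replicate_mset W 0) 0 + w \<in> Uhat k"
    proof (rule power_of_alpha[OF k])
      fix N assume N: "int (wt N) = int W - 4 * int k"
      \<comment> \<open>The charge 2 part has weight W - 4k >= 200k + 16, above the bound 20k + 6
        valid in charge 2.\<close>
      have "graded (int 2) (int (wt N)) (int (size N)) \<subseteq> Uhat k"
        using N W k by (intro charged_large_weight) auto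
      then show "basis_vec N 2 \<in> Uhat k"
        using basis_in_graded[OF refl order_refl, of N "int 2"] by auto
    qed (use W in simp)
    then obtain w where "w \<in> graded 0 (int W) (int W - 1)" "basis_vec M 0 + w \<in> Uhat k"
      using M size by metis
    with IH[of "int W - 1"] size show ?thesis
      by (auto intro: subspace_cancel_add[OF U])
  next
    case 4
    then obtain p N1 where p: "p > 0" "M = add_mset p N1"
      by (metis multi_member_split)
    with 4(1) obtain q N2 where q: "N1 = add_mset q N2" "size N2 \<ge> 1"
      by (cases N1) auto
    then obtain s N where s: "N2 = add_mset s N"
      by (cases N2) auto
    have eq: "int (wt N) + int (p + q + s) + 3 = int W"
      using less.prems by (simp add: p q s)
    have "cre p (cre q (cre s (basis_vec N 0))) \<in> Uhat k"
    proof (rule triple_in_Uhat[OF basis_in_graded[OF refl order_refl]])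
      show "graded 0 (int (wt N) + int (p + q + s) + 3) (int (size N) + 2) \<subseteq> Uhat k"
        unfolding eq by (rule IH) (simp add: p q s)
    qed (use p in simp)
    then have "smult_VL (fact s) (cre p (cre q (basis_vec N2 0))) \<in> Uhat k"
      by (simp add: s cre_basis[of s])
    then have "cre p (cre q (basis_vec N2 0)) \<in> Uhat k"
      by (rule subspace_cancel_scale[OF U]) simp
    then show ?thesis
      unfolding p q by (rule basis_from_pair[OF U])
  qed
qed

section \<open>Cofiniteness\<close>

lemma finite_wt_less: "finite {M. wt M < n}"
proof (induction n)
  case (Suc n)
  have "{M. wt M < Suc n} \<subseteq> insert {#} ((\<lambda>(p, N). add_mset p N) ` ({..n} \<times> {M. wt M < n}))"
  proof
    fix M assume "M \<in> {M. wt M < Suc n}"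
    then show "M \<in> insert {#} ((\<lambda>(p, N). add_mset p N) ` ({..n} \<times> {M. wt M < n}))"
    proof (cases M)
      case (add p N)
      with \<open>M \<in> _\<close> show ?thesis
        by (intro insertI2 image_eqI[of _ _ "(p, N)"]) auto
    qed simp
  qed
  then show ?case
    by (rule finite_subset) (simp add: Suc)
qed simp

text \<open>Charges stop at 20 because \<open>high_charge\<close> starts at 21. The weight bound
  serves all of them at once: charge 20 needs 200k + 6, and charge 0 uses 204k + 16. Negative
  charges are recovered through \<open>theta\<close>.\<close>

definition low_weight :: "nat \<Rightarrow> VL set" where
  "low_weight k = {basis_vec M (int m) | M m. wt M < 204 * k + 16 \<and> m \<le> 20}"

lemma finite_low_weight: "finite (low_weight k)"
proof -
  have "low_weight k = (\<lambda>(M, m). basis_vec M (int m)) ` ({M. wt M < 204 * k + 16} \<times> {..20})"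
    by (auto simp: low_weight_def)
  then show ?thesis
    by (simp add: finite_wt_less)
qed

lemma span_low_weight:
  assumes "k > 0"
  shows "VL.span (Uhat k \<union> low_weight k) = UNIV"
proof -
  let ?Z = "VL.span (Uhat k \<union> low_weight k)"
  have Z: "VL.subspace ?Z" "Uhat k \<subseteq> ?Z"
    by (auto intro: VL.span_base)
  have neg: "basis_vec M (- m) \<in> ?Z" if "basis_vec M m \<in> ?Z" for M m
  proof (rule subspace_cancel_diff[OF Z(1)])
    show "basis_vec M (- m) - theta (basis_vec M (- m)) \<in> ?Z"
      using Z(2) Uhat_minus_theta by blast
    show "theta (basis_vec M (- m)) \<in> ?Z"
      using that by (simp add: theta_basis VL.subspace_scale[OF Z(1)])
  qed
  have nonneg: "basis_vec M (int m) \<in> ?Z" for M m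
  proof (induction m arbitrary: M rule: less_induct)
    case (less m)
    consider "m \<ge> 21" | "m \<le> 20" "wt M < 204 * k + 16" | "m = 0" "wt M \<ge> 204 * k + 16"
      | "0 < m" "m \<le> 20" "wt M \<ge> 204 * k + 16"
      by linarith
    then show ?case
    proof cases
      case 1
      have "basis_vec N l \<in> ?Z" if "\<bar>l\<bar> < int m" for N l
        using less[of "nat \<bar>l\<bar>" N] neg[of N "- l"] that by (cases "l \<ge> 0") auto
      with Z(2) have "low_charge k (int m) \<subseteq> ?Z"
        unfolding low_charge_def by (intro VL.span_minimal[OF _ Z(1)]) auto
      with high_charge[OF assms 1] show ?thesis by blast
    next
      case 2
      then show ?thesis
        by (intro VL.span_base) (auto simp: low_weight_def)
    next
      case 3
      then show ?thesis
        using neutral_large_weight[OF assms, of "wt M" M] Z(2) by auto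
    next
      case 4
      have "10 * k * m \<le> 10 * k * 20"
        using 4(2) by (intro mult_le_mono) auto
      then have "10 * k * m + 6 \<le> wt M"
        using 4(3) by linarith
      then have "graded (int m) (int (wt M)) (int (size M)) \<subseteq> Uhat k"
        by (intro charged_large_weight[OF assms 4(1)]) (simp only: of_nat_le_iff)
      then show ?thesis
        using basis_in_graded[OF refl order_refl] Z(2) by blast
    qed
  qed
  have "basis_vec M m \<in> ?Z" for M m
    using nonneg[of M "nat \<bar>m\<bar>"] neg[of M "- m"] by (cases "m \<ge> 0") auto
  then have "VL.span (range (\<lambda>(M, m). basis_vec M m)) \<subseteq> ?Z"
    by (intro VL.span_minimal[OF _ Z(1)]) auto
  then show ?thesis
    unfolding span_basis by blast
qed

lemma coset_eqI:
  assumes "VL.subspace U" "v - w \<in> U"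
  shows "coset U v = coset U w"
proof -
  have "coset U a \<subseteq> coset U b" if "a - b \<in> U" for a b
  proof
    fix x assume "x \<in> coset U a"
    then obtain y where "x = a + y" "y \<in> U"
      by (auto simp: coset_def)
    then have "x = b + (a - b + y)" "a - b + y \<in> U"
      using VL.subspace_add[OF assms(1) that] by auto
    then show "x \<in> coset U b"
      unfolding coset_def by blast
  qed
  moreover have "w - v \<in> U"
    using VL.subspace_neg[OF assms] by simp
  ultimately show ?thesis
    using assms(2) by blast
qed

theorem mainTheorem2:
  fixes k :: nat
  assumes "k > 0"
  shows "C2_cofinite smult_VL (nprod_VL k) VL_plus"
proof -
  let ?U = "C2 smult_VL (nprod_VL k) VL_plus"
  let ?B = "(\<lambda>b. b + theta b) ` low_weight k"
  have lin: "lin (\<lambda>v. v + theta v)"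
    by (rule lin_plus[OF lin_id lin_theta])
  have fin: "finite ?B"
    by (simp add: finite_low_weight)
  have "\<exists>c. coset ?U v = coset ?U (\<Sum>b\<in>?B. smult_VL (c b) b)" if v: "v \<in> VL_plus" for v
  proof -
    have "smult_VL (1 / 2) v \<in> VL.span (Uhat k \<union> low_weight k)"
      by (simp add: span_low_weight[OF assms])
    then obtain u f where uf: "smult_VL (1 / 2) v = u + f" "u \<in> Uhat k" "f \<in> VL.span (low_weight k)"
      using subspace_Uhat[of k] by (auto simp: VL.span_Un VL.span_eq_iff[THEN iffD2])
    have "v = smult_VL (1 / 2) v + theta (smult_VL (1 / 2) v)"
      using v VL.scale_left_distrib[of "1 / 2" "1 / 2" v] by (simp add: VL_plus_def)
    also have "\<dots> = (u + theta u) + (f + theta f)"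
      unfolding uf(1) by (simp add: ac_simps)
    finally have eq: "v = (u + theta u) + (f + theta f)" .
    have "f + theta f \<in> VL.span ?B"
      using uf(3) lin by (rule span_into[where f = "\<lambda>v. v + theta v"]) (auto intro: VL.span_base)
    then obtain c where c: "f + theta f = (\<Sum>b\<in>?B. smult_VL (c b) b)"
      by (auto simp: VL.span_finite[OF fin])
    have "v - (\<Sum>b\<in>?B. smult_VL (c b) b) \<in> ?U"
      unfolding c[symmetric] eq using uf(2) by (simp add: Uhat_def)
    then show ?thesis
      using coset_eqI[OF subspace_C2] by blast
  qed
  moreover have "?B \<subseteq> VL_plus"
    using sym_in_VL_plus by blast
  ultimately show ?thesis
    unfolding C2_cofinite_def finite_dim_quotient_def using fin by blast
qed

end
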